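(* Let $\mathbf{P}$ be an operad with $\mathbf{P}(0)=(0)$. Then $\mathrm{coinv}\,\mathbf{P}=\bigoplus_{n\ge1}\mathrm{coinv}\,\mathbf{P}(n)$ is a graded pre-Lie algebra, quotient of the graded pre-Lie algebra $(\mathbf{P},\bullet)$, where $\mathbf{P}=\bigoplus_{n\ge1}\mathbf{P}(n)$ and $p\bullet q=\sum_{i=1}^n p\circ_i q$ for $p\in\mathbf{P}(n)$, $q\in\mathbf{P}$.
   Context: An operad (over a field of characteristic zero) is a family of right $\mathfrak{S}_n$-modules $\mathbf{P}(n)$ with associative, equivariant compositions and a unit $I\in\mathbf{P}(1)$; $p\circ_i q$ is the composition of $p$ with $q$ in position $i$ and $I$ in the other positions. $\mathrm{coinv}\,\mathbf{P}(n)=\mathbf{P}(n)/\mathrm{Vect}(p-p^\sigma\mid p\in\mathbf{P}(n),\sigma\in\mathfrak{S}_n)$. Elements of $\mathbf{P}(n)$ and $\mathrm{coinv}\,\mathbf{P}(n)$ have degree $n-1$. Pre-Lie means right pre-Lie: $x\bullet(y\bullet z)-(x\bullet y)\bullet z=x\bullet(z\bullet y)-(x\bullet z)\bullet y$. *)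

theory Defs
  imports "HOL-Combinatorics.Permutations" "HOL-Algebra.Module" "HOL-Algebra.QuotRing"
begin

text \<open>
  The fields \<open>mult\<close> and \<open>one\<close> of the record type of modules are irrelevant for a module;
  \<open>mult\<close> is used below as the (nonassociative) product of an algebra.
\<close>

definition vect :: "('k, 'm) ring_scheme \<Rightarrow> ('k, 'a) module \<Rightarrow> 'a set \<Rightarrow> 'a set" where
  "vect K M S = \<Inter>{H. submodule H K M \<and> S \<subseteq> H}"

definition quotient_module :: "('k, 'a) module \<Rightarrow> 'a set \<Rightarrow> ('k, 'a set) module" where
  "quotient_module M H =
    \<lparr>carrier = a_rcosets\<^bsub>M\<^esub> H, mult = rcoset_mult M H, one = H +>\<^bsub>M\<^esub> \<one>\<^bsub>M\<^esub>,
     zero = H, add = set_add M, smult = (\<lambda>a A. \<Union>x\<in>A. H +>\<^bsub>M\<^esub> (a \<odot>\<^bsub>M\<^esub> x))\<rparr>"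

definition direct_sum :: "'i set \<Rightarrow> ('i \<Rightarrow> ('k, 'a) module) \<Rightarrow> ('k, 'i \<Rightarrow> 'a) module" where
  "direct_sum I M =
    \<lparr>carrier = {f \<in> \<Pi>\<^sub>E i\<in>I. carrier (M i). finite {i \<in> I. f i \<noteq> \<zero>\<^bsub>M i\<^esub>}},
     mult = (\<lambda>f g. \<lambda>i\<in>I. f i \<otimes>\<^bsub>M i\<^esub> g i), one = (\<lambda>i\<in>I. \<one>\<^bsub>M i\<^esub>),
     zero = (\<lambda>i\<in>I. \<zero>\<^bsub>M i\<^esub>), add = (\<lambda>f g. \<lambda>i\<in>I. f i \<oplus>\<^bsub>M i\<^esub> g i),
     smult = (\<lambda>a f. \<lambda>i\<in>I. a \<odot>\<^bsub>M i\<^esub> f i)\<rparr>"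

definition direct_sum_component ::
    "'i set \<Rightarrow> ('i \<Rightarrow> ('k, 'a) module) \<Rightarrow> 'i \<Rightarrow> ('i \<Rightarrow> 'a) set" where
  "direct_sum_component I M n =
    {f \<in> carrier (direct_sum I M). \<forall>i\<in>I. i \<noteq> n \<longrightarrow> f i = \<zero>\<^bsub>M i\<^esub>}"

locale pre_lie_algebra = module K A
  for K :: "('k, 'm) ring_scheme" and A :: "('k, 'a) module" +
  assumes prod_closed:
      "\<lbrakk>x \<in> carrier A; y \<in> carrier A\<rbrakk> \<Longrightarrow> x \<otimes>\<^bsub>A\<^esub> y \<in> carrier A"
    and prod_l_distr:
      "\<lbrakk>x \<in> carrier A; y \<in> carrier A; z \<in> carrier A\<rbrakk> \<Longrightarrow>
        (x \<oplus>\<^bsub>A\<^esub> y) \<otimes>\<^bsub>A\<^esub> z = (x \<otimes>\<^bsub>A\<^esub> z) \<oplus>\<^bsub>A\<^esub> (y \<otimes>\<^bsub>A\<^esub> z)"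
    and prod_r_distr:
      "\<lbrakk>x \<in> carrier A; y \<in> carrier A; z \<in> carrier A\<rbrakk> \<Longrightarrow>
        x \<otimes>\<^bsub>A\<^esub> (y \<oplus>\<^bsub>A\<^esub> z) = (x \<otimes>\<^bsub>A\<^esub> y) \<oplus>\<^bsub>A\<^esub> (x \<otimes>\<^bsub>A\<^esub> z)"
    and prod_smult_l:
      "\<lbrakk>a \<in> carrier K; x \<in> carrier A; y \<in> carrier A\<rbrakk> \<Longrightarrow>
        (a \<odot>\<^bsub>A\<^esub> x) \<otimes>\<^bsub>A\<^esub> y = a \<odot>\<^bsub>A\<^esub> (x \<otimes>\<^bsub>A\<^esub> y)"
    and prod_smult_r:
      "\<lbrakk>a \<in> carrier K; x \<in> carrier A; y \<in> carrier A\<rbrakk> \<Longrightarrow>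
        x \<otimes>\<^bsub>A\<^esub> (a \<odot>\<^bsub>A\<^esub> y) = a \<odot>\<^bsub>A\<^esub> (x \<otimes>\<^bsub>A\<^esub> y)"
    and right_pre_lie:
      "\<lbrakk>x \<in> carrier A; y \<in> carrier A; z \<in> carrier A\<rbrakk> \<Longrightarrow>
        (x \<otimes>\<^bsub>A\<^esub> (y \<otimes>\<^bsub>A\<^esub> z)) \<ominus>\<^bsub>A\<^esub> ((x \<otimes>\<^bsub>A\<^esub> y) \<otimes>\<^bsub>A\<^esub> z) =
        (x \<otimes>\<^bsub>A\<^esub> (z \<otimes>\<^bsub>A\<^esub> y)) \<ominus>\<^bsub>A\<^esub> ((x \<otimes>\<^bsub>A\<^esub> z) \<otimes>\<^bsub>A\<^esub> y)"

text \<open>\<open>G d\<close> is the homogeneous component of degree \<open>d\<close>; \<open>A\<close> is their internal direct sum.\<close>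

locale graded_pre_lie_algebra = pre_lie_algebra K A
  for K :: "('k, 'm) ring_scheme" and A :: "('k, 'a) module" and G :: "nat \<Rightarrow> 'a set" +
  assumes component_submodule: "submodule (G d) K A"
    and unique_decomposition:
      "x \<in> carrier A \<Longrightarrow>
        \<exists>!f. (\<forall>d. f d \<in> G d) \<and> finite {d. f d \<noteq> \<zero>\<^bsub>A\<^esub>} \<and>
             x = (\<Oplus>\<^bsub>A\<^esub> d \<in> {d. f d \<noteq> \<zero>\<^bsub>A\<^esub>}. f d)"
    and prod_degree: "\<lbrakk>x \<in> G d; y \<in> G e\<rbrakk> \<Longrightarrow> x \<otimes>\<^bsub>A\<^esub> y \<in> G (d + e)"

definition graded_algebra_hom ::
    "('k, 'm) ring_scheme \<Rightarrow> ('k, 'a) module \<Rightarrow> (nat \<Rightarrow> 'a set) \<Rightarrow>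
      ('k, 'b) module \<Rightarrow> (nat \<Rightarrow> 'b set) \<Rightarrow> ('a \<Rightarrow> 'b) set" where
  "graded_algebra_hom K A G B H =
    {h. h \<in> carrier A \<rightarrow> carrier B \<and>
        (\<forall>x\<in>carrier A. \<forall>y\<in>carrier A. h (x \<oplus>\<^bsub>A\<^esub> y) = h x \<oplus>\<^bsub>B\<^esub> h y) \<and>
        (\<forall>a\<in>carrier K. \<forall>x\<in>carrier A. h (a \<odot>\<^bsub>A\<^esub> x) = a \<odot>\<^bsub>B\<^esub> h x) \<and>
        (\<forall>x\<in>carrier A. \<forall>y\<in>carrier A. h (x \<otimes>\<^bsub>A\<^esub> y) = h x \<otimes>\<^bsub>B\<^esub> h y) \<and>
        (\<forall>d. \<forall>x\<in>G d. h x \<in> H d)}"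

text \<open>
  A list \<open>ks\<close> of block lengths cuts \<open>{..<sum_list ks}\<close> into consecutive blocks; the block with
  number \<open>j < length ks\<close> starts at \<open>block_start ks j\<close>. The element \<open>m\<close> lies in the block
  with number \<open>block_of ks m\<close> (blocks may be empty).
\<close>

definition block_start :: "nat list \<Rightarrow> nat \<Rightarrow> nat" where
  "block_start ks j = sum_list (take j ks)"

definition block_of :: "nat list \<Rightarrow> nat \<Rightarrow> nat" where
  "block_of ks m = (LEAST j. m < block_start ks (Suc j))"

text \<open>
  The permutation moving, as a whole, the block at place \<open>j\<close> to place \<open>\<sigma> j\<close>. Afterwards the
  block lengths are \<open>permute_list (inv \<sigma>) ks\<close>, that is, the length at place \<open>i\<close> is that of
  block \<open>inv \<sigma> i\<close>.
\<close>

definition block_perm :: "nat list \<Rightarrow> (nat \<Rightarrow> nat) \<Rightarrow> nat \<Rightarrow> nat" where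
  "block_perm ks \<sigma> m =
    (if m < sum_list ks
     then block_start (permute_list (inv_into UNIV \<sigma>) ks) (\<sigma> (block_of ks m))
          + (m - block_start ks (block_of ks m))
     else m)"

text \<open>The permutation acting on the block with number \<open>j\<close> by \<open>\<tau>s ! j\<close>.\<close>

definition block_sum :: "nat list \<Rightarrow> (nat \<Rightarrow> nat) list \<Rightarrow> nat \<Rightarrow> nat" where
  "block_sum ks \<tau>s m =
    (if m < sum_list ks
     then block_start ks (block_of ks m)
          + (\<tau>s ! block_of ks m) (m - block_start ks (block_of ks m))
     else m)"

text \<open>
  Inputs of an \<open>n\<close>-ary operation are numbered \<open>0, \<dots>, n - 1\<close>, and the symmetric group consists of
  the \<open>\<sigma>\<close> with \<open>\<sigma> permutes {..<n}\<close>. The element \<open>act n p \<sigma>\<close> is \<open>p\<^sup>\<sigma>\<close>. For \<open>p\<close> of arity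
  \<open>length ks\<close> and \<open>qs ! j\<close> of arity \<open>ks ! j\<close>, the composition of \<open>p\<close> with all the \<open>qs\<close> is
  \<open>\<gamma> ks p qs\<close>; the arities are arguments because the carriers of the \<open>P n\<close> need not be disjoint.

  The equivariance conditions are those satisfied by multilinear operations under the right action
  \<open>(p\<^sup>\<sigma>)(x\<^sub>1, \<dots>, x\<^sub>n) = p (x\<^bsub>inv \<sigma> 1\<^esub>, \<dots>, x\<^bsub>inv \<sigma> n\<^esub>)\<close>.
\<close>

abbreviation tuple_in :: "(nat \<Rightarrow> ('k, 'a) module) \<Rightarrow> nat list \<Rightarrow> 'a list \<Rightarrow> bool" where
  "tuple_in P ks qs \<equiv> list_all2 (\<lambda>k q. q \<in> carrier (P k)) ks qs"

locale operad = field K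
  for K :: "('k, 'm) ring_scheme" +
  fixes P :: "nat \<Rightarrow> ('k, 'a) module"
    and act :: "nat \<Rightarrow> 'a \<Rightarrow> (nat \<Rightarrow> nat) \<Rightarrow> 'a"
    and \<gamma> :: "nat list \<Rightarrow> 'a \<Rightarrow> 'a list \<Rightarrow> 'a"
    and I :: 'a
  assumes char_zero: "\<And>n::nat. n > 0 \<Longrightarrow> [n] \<cdot>\<^bsub>K\<^esub> \<one>\<^bsub>K\<^esub> \<noteq> \<zero>\<^bsub>K\<^esub>"
    and module_P: "module K (P n)"
    and act_closed:
      "\<lbrakk>p \<in> carrier (P n); \<sigma> permutes {..<n}\<rbrakk> \<Longrightarrow> act n p \<sigma> \<in> carrier (P n)"
    and act_add:
      "\<lbrakk>p \<in> carrier (P n); p' \<in> carrier (P n); \<sigma> permutes {..<n}\<rbrakk> \<Longrightarrow>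
        act n (p \<oplus>\<^bsub>P n\<^esub> p') \<sigma> = act n p \<sigma> \<oplus>\<^bsub>P n\<^esub> act n p' \<sigma>"
    and act_smult:
      "\<lbrakk>a \<in> carrier K; p \<in> carrier (P n); \<sigma> permutes {..<n}\<rbrakk> \<Longrightarrow>
        act n (a \<odot>\<^bsub>P n\<^esub> p) \<sigma> = a \<odot>\<^bsub>P n\<^esub> act n p \<sigma>"
    and act_id: "p \<in> carrier (P n) \<Longrightarrow> act n p id = p"
    and act_comp:
      "\<lbrakk>p \<in> carrier (P n); \<sigma> permutes {..<n}; \<tau> permutes {..<n}\<rbrakk> \<Longrightarrow>
        act n p (\<sigma> \<circ> \<tau>) = act n (act n p \<sigma>) \<tau>"
    and comp_closed:
      "\<lbrakk>p \<in> carrier (P (length ks)); tuple_in P ks qs\<rbrakk> \<Longrightarrow>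
        \<gamma> ks p qs \<in> carrier (P (sum_list ks))"
    and comp_add_l:
      "\<lbrakk>p \<in> carrier (P (length ks)); p' \<in> carrier (P (length ks)); tuple_in P ks qs\<rbrakk> \<Longrightarrow>
        \<gamma> ks (p \<oplus>\<^bsub>P (length ks)\<^esub> p') qs = \<gamma> ks p qs \<oplus>\<^bsub>P (sum_list ks)\<^esub> \<gamma> ks p' qs"
    and comp_smult_l:
      "\<lbrakk>a \<in> carrier K; p \<in> carrier (P (length ks)); tuple_in P ks qs\<rbrakk> \<Longrightarrow>
        \<gamma> ks (a \<odot>\<^bsub>P (length ks)\<^esub> p) qs = a \<odot>\<^bsub>P (sum_list ks)\<^esub> \<gamma> ks p qs"
    and comp_add_r:
      "\<lbrakk>p \<in> carrier (P (length ks)); tuple_in P ks qs; j < length ks;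
        q \<in> carrier (P (ks ! j)); q' \<in> carrier (P (ks ! j))\<rbrakk> \<Longrightarrow>
        \<gamma> ks p (qs[j := q \<oplus>\<^bsub>P (ks ! j)\<^esub> q']) =
        \<gamma> ks p (qs[j := q]) \<oplus>\<^bsub>P (sum_list ks)\<^esub> \<gamma> ks p (qs[j := q'])"
    and comp_smult_r:
      "\<lbrakk>a \<in> carrier K; p \<in> carrier (P (length ks)); tuple_in P ks qs; j < length ks;
        q \<in> carrier (P (ks ! j))\<rbrakk> \<Longrightarrow>
        \<gamma> ks p (qs[j := a \<odot>\<^bsub>P (ks ! j)\<^esub> q]) = a \<odot>\<^bsub>P (sum_list ks)\<^esub> \<gamma> ks p (qs[j := q])"
    \<comment> \<open>associativity: \<open>rss ! j\<close> are the elements, of arities \<open>kss ! j\<close>, inserted into \<open>qs ! j\<close>\<close>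
    and comp_assoc:
      "\<lbrakk>p \<in> carrier (P (length kss)); tuple_in P (map length kss) qs;
        list_all2 (tuple_in P) kss rss\<rbrakk> \<Longrightarrow>
        \<gamma> (concat kss) (\<gamma> (map length kss) p qs) (concat rss) =
        \<gamma> (map sum_list kss) p
          (map (\<lambda>j. \<gamma> (kss ! j) (qs ! j) (rss ! j)) [0..<length kss])"
    and unit_closed: "I \<in> carrier (P 1)"
    and unit_l: "q \<in> carrier (P n) \<Longrightarrow> \<gamma> [n] I [q] = q"
    and unit_r: "p \<in> carrier (P n) \<Longrightarrow> \<gamma> (replicate n 1) p (replicate n I) = p"
    and equivariance_outer:
      "\<lbrakk>p \<in> carrier (P (length ks)); tuple_in P ks qs; \<sigma> permutes {..<length ks}\<rbrakk> \<Longrightarrow>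
        \<gamma> ks (act (length ks) p \<sigma>) qs =
        act (sum_list ks) (\<gamma> (permute_list (inv_into UNIV \<sigma>) ks) p (permute_list (inv_into UNIV \<sigma>) qs))
          (block_perm ks \<sigma>)"
    and equivariance_inner:
      "\<lbrakk>p \<in> carrier (P (length ks)); tuple_in P ks qs;
        list_all2 (\<lambda>k \<tau>. \<tau> permutes {..<k}) ks \<tau>s\<rbrakk> \<Longrightarrow>
        \<gamma> ks p (map (\<lambda>j. act (ks ! j) (qs ! j) (\<tau>s ! j)) [0..<length ks]) =
        act (sum_list ks) (\<gamma> ks p qs) (block_sum ks \<tau>s)"

text \<open>\<open>p \<circ>\<^sub>i q\<close> for \<open>p\<close> of arity \<open>n\<close> and \<open>q\<close> of arity \<open>m\<close>, with inputs \<open>i\<close> numbered from \<open>0\<close>.\<close>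

definition partial_comp ::
    "(nat list \<Rightarrow> 'a \<Rightarrow> 'a list \<Rightarrow> 'a) \<Rightarrow> 'a \<Rightarrow> nat \<Rightarrow> nat \<Rightarrow> nat \<Rightarrow> 'a \<Rightarrow> 'a \<Rightarrow> 'a" where
  "partial_comp \<gamma> I n m i p q = \<gamma> ((replicate n 1)[i := m]) p ((replicate n I)[i := q])"

definition bullet ::
    "(nat \<Rightarrow> ('k, 'a) module) \<Rightarrow> (nat list \<Rightarrow> 'a \<Rightarrow> 'a list \<Rightarrow> 'a) \<Rightarrow> 'a \<Rightarrow>
      nat \<Rightarrow> nat \<Rightarrow> 'a \<Rightarrow> 'a \<Rightarrow> 'a" where
  "bullet P \<gamma> I n m p q = (\<Oplus>\<^bsub>P (n + m - 1)\<^esub> i \<in> {..<n}. partial_comp \<gamma> I n m i p q)"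

text \<open>
  The bilinear extension of \<open>\<bullet>\<close> to the direct sum: the part of arity \<open>r\<close> collects the
  products of parts of arities \<open>n\<close> and \<open>m\<close> with \<open>n + m - 1 = r\<close>.
\<close>

definition operad_algebra ::
    "(nat \<Rightarrow> ('k, 'a) module) \<Rightarrow> (nat list \<Rightarrow> 'a \<Rightarrow> 'a list \<Rightarrow> 'a) \<Rightarrow> 'a \<Rightarrow>
      ('k, nat \<Rightarrow> 'a) module" where
  "operad_algebra P \<gamma> I =
    (direct_sum {1..} P)\<lparr>mult :=
      (\<lambda>f g. \<lambda>r\<in>{1..}. \<Oplus>\<^bsub>P r\<^esub> n \<in> {1..r}. bullet P \<gamma> I n (r + 1 - n) (f n) (g (r + 1 - n)))\<rparr>"

definition coinv_kernel ::
    "('k, 'm) ring_scheme \<Rightarrow> (nat \<Rightarrow> ('k, 'a) module) \<Rightarrow>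
      (nat \<Rightarrow> 'a \<Rightarrow> (nat \<Rightarrow> nat) \<Rightarrow> 'a) \<Rightarrow> nat \<Rightarrow> 'a set" where
  "coinv_kernel K P act n =
    vect K (P n) {p \<ominus>\<^bsub>P n\<^esub> act n p \<sigma> | p \<sigma>. p \<in> carrier (P n) \<and> \<sigma> permutes {..<n}}"

definition coinv ::
    "('k, 'm) ring_scheme \<Rightarrow> (nat \<Rightarrow> ('k, 'a) module) \<Rightarrow>
      (nat \<Rightarrow> 'a \<Rightarrow> (nat \<Rightarrow> nat) \<Rightarrow> 'a) \<Rightarrow> nat \<Rightarrow> ('k, 'a set) module" where
  "coinv K P act n = quotient_module (P n) (coinv_kernel K P act n)"

definition coinv_proj ::
    "('k, 'm) ring_scheme \<Rightarrow> (nat \<Rightarrow> ('k, 'a) module) \<Rightarrow>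
      (nat \<Rightarrow> 'a \<Rightarrow> (nat \<Rightarrow> nat) \<Rightarrow> 'a) \<Rightarrow> (nat \<Rightarrow> 'a) \<Rightarrow> nat \<Rightarrow> 'a set" where
  "coinv_proj K P act f = (\<lambda>n\<in>{1..}. coinv_kernel K P act n +>\<^bsub>P n\<^esub> f n)"

definition coinv_sum ::
    "('k, 'm) ring_scheme \<Rightarrow> (nat \<Rightarrow> ('k, 'a) module) \<Rightarrow>
      (nat \<Rightarrow> 'a \<Rightarrow> (nat \<Rightarrow> nat) \<Rightarrow> 'a) \<Rightarrow> ('k, nat \<Rightarrow> 'a set) module" where
  "coinv_sum K P act = direct_sum {1..} (coinv K P act)"

definition coinv_algebra ::
    "('k, 'm) ring_scheme \<Rightarrow> (nat \<Rightarrow> ('k, 'a) module) \<Rightarrow>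
      (nat \<Rightarrow> 'a \<Rightarrow> (nat \<Rightarrow> nat) \<Rightarrow> 'a) \<Rightarrow>
      ((nat \<Rightarrow> 'a set) \<Rightarrow> (nat \<Rightarrow> 'a set) \<Rightarrow> nat \<Rightarrow> 'a set) \<Rightarrow> ('k, nat \<Rightarrow> 'a set) module" where
  "coinv_algebra K P act m = (coinv_sum K P act)\<lparr>mult := m\<rparr>"

text \<open>The elements of degree \<open>d\<close> of a direct sum over the arities \<open>n \<ge> 1\<close> are those of arity
  \<open>n = d + 1\<close>.\<close>

definition degree_part :: "(nat \<Rightarrow> ('k, 'a) module) \<Rightarrow> nat \<Rightarrow> (nat \<Rightarrow> 'a) set" where
  "degree_part M d = direct_sum_component {1..} M (d + 1)"

end

theory Submission
  imports Defs
begin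

text \<open>
  Inserting \<open>r\<close> into \<open>p \<circ>\<^sub>i q\<close> either hits an input of \<open>q\<close> or another input \<open>j \<noteq> i\<close> of \<open>p\<close>, so
  \<open>(p \<bullet> q) \<bullet> r = p \<bullet> (q \<bullet> r) + \<Sum>\<^bsub>i \<noteq> j\<^esub> \<gamma>(p; q at i, r at j)\<close>. The double sum is symmetric in
  \<open>q\<close> and \<open>r\<close>, which is the right pre-Lie identity.

  The relations \<open>p - p\<^sup>\<sigma>\<close> span an ideal: by equivariance \<open>p \<circ>\<^sub>i q\<^sup>\<tau>\<close> is a permuted \<open>p \<circ>\<^sub>i q\<close>, and
  \<open>p\<^sup>\<sigma> \<circ>\<^sub>i q\<close> is a permuted \<open>p \<circ>\<^bsub>\<sigma> i\<^esub> q\<close>, where \<open>\<sigma>\<close> only reorders the summands of \<open>p \<bullet> q\<close>.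
\<close>

subsection \<open>Finite sums in abelian groups\<close>

text \<open>In general the single terms \<open>p \<circ>\<^sub>i q\<close> do not descend to
  coinvariants in the argument \<open>p\<close>, because the action moves the input
  \<open>i\<close>; only the sum over all inputs does. Hence the ideal property can be checked term
  by term in \<open>q\<close>, but needs the whole sum in \<open>p\<close>. The operad is given by
  full compositions \<open>\<gamma>\<close>, so both laws for iterated one-input insertions have to
  be read off from \<open>comp_assoc\<close> by filling the other inputs with \<open>I\<close>. The
  price is the renumbering of inputs after an insertion. All components of the direct sum have arity
  at least 1, which keeps truncated differences such as \<open>n + m - 1\<close> and
  \<open>n + m + k - 2\<close> exact. The product on coinvariants is chosen through representatives;
  its laws are pushed forward along the surjection \<open>coinv_proj\<close>, and the same
  surjectivity makes it unique.\<close>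

lemma (in abelian_monoid) finsum_Sigma:
  assumes "finite A" "\<And>i. i \<in> A \<Longrightarrow> finite (B i)"
    and "\<And>i j. i \<in> A \<Longrightarrow> j \<in> B i \<Longrightarrow> f i j \<in> carrier G"
  shows "(\<Oplus>i\<in>A. \<Oplus>j\<in>B i. f i j) = (\<Oplus>p\<in>Sigma A B. case_prod f p)"
  using assms
proof (induction A rule: finite_induct)
  case (insert a A)
  have "Sigma (insert a A) B = Pair a ` B a \<union> Sigma A B" by auto
  moreover have "(\<Oplus>p\<in>Pair a ` B a \<union> Sigma A B. case_prod f p) =
      (\<Oplus>p\<in>Pair a ` B a. case_prod f p) \<oplus> (\<Oplus>p\<in>Sigma A B. case_prod f p)"
    by (intro finsum_Un_disjoint) (use insert in auto)
  moreover have "(\<Oplus>p\<in>Pair a ` B a. case_prod f p) = (\<Oplus>j\<in>B a. f a j)"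
    by (subst finsum_reindex) (use insert in \<open>auto simp: inj_on_def\<close>)
  moreover have "(\<Oplus>i\<in>insert a A. \<Oplus>j\<in>B i. f i j) =
      (\<Oplus>j\<in>B a. f a j) \<oplus> (\<Oplus>i\<in>A. \<Oplus>j\<in>B i. f i j)"
    by (intro finsum_insert) (use insert in \<open>auto intro!: finsum_closed\<close>)
  ultimately show ?case using insert by simp
qed auto

text \<open>Serves every change of variables in a double sum below: interchanging two sums, swapping
  a pair of inputs, and passing between two ways of indexing triples of arities. The index sets may
  be dependent, since ranges such as \<open>{..<n} - {i}\<close> and \<open>{1..s}\<close>
  occur.\<close>

lemma (in abelian_monoid) finsum_nested_reindex:
  assumes fin: "finite A" "\<And>i. i \<in> A \<Longrightarrow> finite (B i)" "finite C" "\<And>i. i \<in> C \<Longrightarrow> finite (D i)"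
    and closed: "\<And>i j. i \<in> A \<Longrightarrow> j \<in> B i \<Longrightarrow> f i j \<in> carrier G"
    and bij: "bij_betw h (Sigma C D) (Sigma A B)"
    and eq: "\<And>c d. c \<in> C \<Longrightarrow> d \<in> D c \<Longrightarrow> g c d = case_prod f (h (c, d))"
  shows "(\<Oplus>i\<in>A. \<Oplus>j\<in>B i. f i j) = (\<Oplus>c\<in>C. \<Oplus>d\<in>D c. g c d)"
proof -
  have img: "h ` Sigma C D = Sigma A B" and inj: "inj_on h (Sigma C D)"
    using bij by (auto simp: bij_betw_def)
  have g_closed: "g c d \<in> carrier G" if "c \<in> C" "d \<in> D c" for c d
  proof -
    have "h (c, d) \<in> Sigma A B" using that img by blast
    then show ?thesis using eq[OF that] closed by (auto split: prod.splits)
  qed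
  have "(\<Oplus>i\<in>A. \<Oplus>j\<in>B i. f i j) = (\<Oplus>p\<in>h ` Sigma C D. case_prod f p)"
    unfolding img by (rule finsum_Sigma) (use fin closed in auto)
  also have "\<dots> = (\<Oplus>p\<in>Sigma C D. case_prod f (h p))"
    by (rule finsum_reindex) (use inj closed img in auto)
  also have "\<dots> = (\<Oplus>p\<in>Sigma C D. case_prod g p)"
    by (rule finsum_cong') (use eq g_closed in auto)
  also have "\<dots> = (\<Oplus>c\<in>C. \<Oplus>d\<in>D c. g c d)"
    by (rule finsum_Sigma[symmetric]) (use fin g_closed in auto)
  finally show ?thesis .
qed

section \<open>Additive maps between abelian groups\<close>

lemma additive_zero:
  assumes "abelian_group G" "abelian_group H" "h \<in> carrier G \<rightarrow> carrier H"
    and "\<And>x y. x \<in> carrier G \<Longrightarrow> y \<in> carrier G \<Longrightarrow> h (x \<oplus>\<^bsub>G\<^esub> y) = h x \<oplus>\<^bsub>H\<^esub> h y"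
  shows "h \<zero>\<^bsub>G\<^esub> = \<zero>\<^bsub>H\<^esub>"
proof -
  interpret G: abelian_group G by fact
  interpret H: abelian_group H by fact
  have "h \<zero>\<^bsub>G\<^esub> \<oplus>\<^bsub>H\<^esub> h \<zero>\<^bsub>G\<^esub> = h \<zero>\<^bsub>G\<^esub>"
    using assms(4)[of "\<zero>\<^bsub>G\<^esub>" "\<zero>\<^bsub>G\<^esub>"] by simp
  then show ?thesis using assms(3) by (metis G.zero_closed H.add.r_cancel_one' PiE)
qed

text \<open>The map \<open>h\<close> is a bare function that is additive on the carrier, so that
  evaluation at a component, \<open>bullet\<close> or a partial composition with one argument fixed,
  and the product of the algebra can all take its place without being packaged as
  homomorphisms.\<close>

lemma additive_minus:
  assumes "abelian_group G" "abelian_group H" "h \<in> carrier G \<rightarrow> carrier H"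
    and add: "\<And>x y. x \<in> carrier G \<Longrightarrow> y \<in> carrier G \<Longrightarrow> h (x \<oplus>\<^bsub>G\<^esub> y) = h x \<oplus>\<^bsub>H\<^esub> h y"
    and xy: "x \<in> carrier G" "y \<in> carrier G"
  shows "h (x \<ominus>\<^bsub>G\<^esub> y) = h x \<ominus>\<^bsub>H\<^esub> h y"
proof -
  interpret G: abelian_group G by fact
  interpret H: abelian_group H by fact
  have "h (\<ominus>\<^bsub>G\<^esub> y) \<oplus>\<^bsub>H\<^esub> h y = \<zero>\<^bsub>H\<^esub>"
    using add[of "\<ominus>\<^bsub>G\<^esub> y" y] xy additive_zero[OF assms(1-4)] by (simp add: G.l_neg)
  moreover have "h (\<ominus>\<^bsub>G\<^esub> y) \<in> carrier H" "h y \<in> carrier H" using assms(3) xy by auto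
  ultimately have "h (\<ominus>\<^bsub>G\<^esub> y) = \<ominus>\<^bsub>H\<^esub> h y" using H.minus_equality by metis
  then show ?thesis using add xy by (simp add: a_minus_def)
qed

lemma additive_finsum:
  assumes "abelian_group G" "abelian_group H" "h \<in> carrier G \<rightarrow> carrier H"
    and add: "\<And>x y. x \<in> carrier G \<Longrightarrow> y \<in> carrier G \<Longrightarrow> h (x \<oplus>\<^bsub>G\<^esub> y) = h x \<oplus>\<^bsub>H\<^esub> h y"
    and "f \<in> A \<rightarrow> carrier G"
  shows "h (\<Oplus>\<^bsub>G\<^esub>i\<in>A. f i) = (\<Oplus>\<^bsub>H\<^esub>i\<in>A. h (f i))"
proof -
  interpret G: abelian_group G by fact
  interpret H: abelian_group H by fact
  show ?thesis using assms(5)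
  \<comment> \<open>A sum over an infinite index set is zero by convention, so that case reduces to
    \<open>h\<close> preserving zero.\<close>
  proof (induction A rule: infinite_finite_induct)
    case (insert a A)
    then have *: "f a \<in> carrier G" "f \<in> A \<rightarrow> carrier G" by auto
    moreover have "h (f a) \<in> carrier H" "(\<lambda>i. h (f i)) \<in> A \<rightarrow> carrier H"
      using assms(3) * by auto
    ultimately show ?case using insert by (simp add: add)
  qed (use additive_zero[OF assms(1-4)] in \<open>simp_all\<close>)
qed

lemma (in abelian_group) finsum_minus:
  assumes "f \<in> A \<rightarrow> carrier G" "g \<in> A \<rightarrow> carrier G"
  shows "(\<Oplus>i\<in>A. f i) \<ominus> (\<Oplus>i\<in>A. g i) = (\<Oplus>i\<in>A. f i \<ominus> g i)"
proof -
  have d: "(\<lambda>i. f i \<ominus> g i) \<in> A \<rightarrow> carrier G" using assms by auto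
  have "(\<Oplus>i\<in>A. f i) = (\<Oplus>i\<in>A. (f i \<ominus> g i) \<oplus> g i)"
    by (rule finsum_cong') (use assms in \<open>auto simp: a_minus_def a_assoc l_neg Pi_iff\<close>)
  also have "\<dots> = (\<Oplus>i\<in>A. f i \<ominus> g i) \<oplus> (\<Oplus>i\<in>A. g i)"
    by (rule finsum_addf[OF d assms(2)])
  finally show ?thesis
    using finsum_closed[OF d] finsum_closed[OF assms(2)] by (simp add: a_minus_def a_assoc r_neg)
qed

lemma (in module) submodule_finsum:
  assumes H: "submodule H R M" and f: "\<And>i. i \<in> A \<Longrightarrow> f i \<in> H"
  shows "(\<Oplus>\<^bsub>M\<^esub>i\<in>A. f i) \<in> H"
proof -
  have zero: "\<zero>\<^bsub>M\<^esub> \<in> H" using subgroup.one_closed[OF submodule.axioms(1)[OF H]] by simp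
  show ?thesis using f
  proof (induction A rule: infinite_finite_induct)
    case (insert a A)
    moreover have "f \<in> A \<rightarrow> carrier M" "f a \<in> carrier M"
      using insert(4) submoduleE(1)[OF H] by auto
    ultimately show ?case using submoduleE(5)[OF H] by simp
  qed (use zero in auto)
qed

text \<open>The module axioms read only the carrier, zero, addition and scalar multiplication. Both
  algebras of the theorem are direct sums whose \<open>mult\<close> field is replaced by the
  product, and this lemma carries the module structure over.\<close>

lemma module_mult_update:
  assumes "module K A"
  shows "module K (A\<lparr>mult := m\<rparr>)"
proof -
  interpret module K A by fact
  show ?thesis
    by (intro moduleI abelian_groupI)
      (auto simp: M.a_ac smult_l_distr smult_r_distr smult_assoc1 R.is_cring
        intro: M.l_neg M.add.inv_closed bexI[of _ "\<ominus>\<^bsub>A\<^esub> _"])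
qed

lemma a_minus_mult_update: "x \<ominus>\<^bsub>A\<lparr>mult := m\<rparr>\<^esub> y = x \<ominus>\<^bsub>A\<^esub> (y :: 'a)"
  for A :: "('k, 'a) module"
  by (simp add: a_minus_def a_inv_def)

lemma finsum_mult_update: "finsum (A\<lparr>mult := m\<rparr>) f S = finsum A f S"
  for A :: "('k, 'a) module"
  by (simp add: finsum_def)

lemma submodule_mult_update: "submodule H K (A\<lparr>mult := m\<rparr>) \<longleftrightarrow> submodule H K A"
  for A :: "('k, 'a) module"
  by (simp add: submodule_def submodule_axioms_def)

subsection \<open>Direct sums\<close>

lemma direct_sum_simps [simp]:
  "i \<in> I \<Longrightarrow> (x \<oplus>\<^bsub>direct_sum I M\<^esub> y) i = x i \<oplus>\<^bsub>M i\<^esub> y i"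
  "i \<in> I \<Longrightarrow> \<zero>\<^bsub>direct_sum I M\<^esub> i = \<zero>\<^bsub>M i\<^esub>"
  "i \<in> I \<Longrightarrow> (a \<odot>\<^bsub>direct_sum I M\<^esub> x) i = a \<odot>\<^bsub>M i\<^esub> x i"
  by (simp_all add: direct_sum_def)

lemma direct_sum_component_closed:
  "x \<in> carrier (direct_sum I M) \<Longrightarrow> i \<in> I \<Longrightarrow> x i \<in> carrier (M i)"
  by (auto simp: direct_sum_def)

lemma direct_sum_finite_support:
  "x \<in> carrier (direct_sum I M) \<Longrightarrow> finite {i \<in> I. x i \<noteq> \<zero>\<^bsub>M i\<^esub>}"
  by (simp add: direct_sum_def)

text \<open>Cancellation makes the exact support of a sum or a product inaccessible; any finite set
  \<open>S\<close> outside which \<open>f\<close> vanishes is enough.\<close>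

lemma direct_sum_carrierI:
  assumes "\<And>i. i \<in> I \<Longrightarrow> f i \<in> carrier (M i)" "f \<in> extensional I"
    and "finite S" "\<And>i. i \<in> I \<Longrightarrow> i \<notin> S \<Longrightarrow> f i = \<zero>\<^bsub>M i\<^esub>"
  shows "f \<in> carrier (direct_sum I M)"
proof -
  have "{i \<in> I. f i \<noteq> \<zero>\<^bsub>M i\<^esub>} \<subseteq> S" using assms(4) by blast
  then show ?thesis
    using assms finite_subset by (auto simp: direct_sum_def PiE_def)
qed

lemma direct_sum_eqI:
  assumes "x \<in> carrier (direct_sum I M)" "y \<in> carrier (direct_sum I M)"
    and "\<And>i. i \<in> I \<Longrightarrow> x i = y i"
  shows "x = y"
  by (rule extensionalityI[of _ I]) (use assms in \<open>auto simp: direct_sum_def PiE_def\<close>)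

context
  fixes K :: "('k, 'm) ring_scheme" and I :: "'i set" and M :: "'i \<Rightarrow> ('k, 'a) module"
  assumes cring_K: "cring K" and module_M: "\<And>i. i \<in> I \<Longrightarrow> module K (M i)"
begin

lemma direct_sum_module: "module K (direct_sum I M)"
proof -
  let ?D = "direct_sum I M"
  interpret K: cring K by (rule cring_K)
  note comp = direct_sum_component_closed and fin = direct_sum_finite_support
  have grp: "abelian_group (M i)" and mon: "abelian_monoid (M i)" if "i \<in> I" for i
    using module_M[OF that] by (auto simp: module_def abelian_group_def)
  note mon_rules = abelian_monoid.l_zero[OF mon] abelian_monoid.zero_closed[OF mon]
    abelian_monoid.a_closed[OF mon] module.smult_closed[OF module_M]
    module.smult_r_null[OF module_M]
  have zero: "\<zero>\<^bsub>?D\<^esub> \<in> carrier ?D"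
    by (rule direct_sum_carrierI[where S = "{}"]) (auto simp: mon_rules, simp add: direct_sum_def)
  have add: "x \<oplus>\<^bsub>?D\<^esub> y \<in> carrier ?D" if "x \<in> carrier ?D" "y \<in> carrier ?D" for x y
    by (rule direct_sum_carrierI[where S = "{i \<in> I. x i \<noteq> \<zero>\<^bsub>M i\<^esub>} \<union> {i \<in> I. y i \<noteq> \<zero>\<^bsub>M i\<^esub>}"])
      (use that in \<open>auto simp: mon_rules comp fin\<close>, simp add: direct_sum_def)
  have smult: "a \<odot>\<^bsub>?D\<^esub> x \<in> carrier ?D" if "a \<in> carrier K" "x \<in> carrier ?D" for a x
    by (rule direct_sum_carrierI[where S = "{i \<in> I. x i \<noteq> \<zero>\<^bsub>M i\<^esub>}"])
      (use that in \<open>auto simp: mon_rules comp fin\<close>, simp add: direct_sum_def)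
  show ?thesis
  \<comment> \<open>Each axiom that is an equation is reduced to its components. Only the existence
    of negatives needs an element to be constructed.\<close>
  proof (intro moduleI abelian_groupI cring_K zero add smult; (rule direct_sum_eqI[of _ I M])?)
    fix x assume x: "x \<in> carrier ?D"
    have inv: "(\<lambda>i\<in>I. \<ominus>\<^bsub>M i\<^esub> x i) \<in> carrier ?D"
    proof (rule direct_sum_carrierI[where S = "{i \<in> I. x i \<noteq> \<zero>\<^bsub>M i\<^esub>}"])
      fix i assume i: "i \<in> I"
      interpret module K "M i" by (rule module_M) fact
      show "(\<lambda>i\<in>I. \<ominus>\<^bsub>M i\<^esub> x i) i \<in> carrier (M i)"
        using i x by (simp add: comp)
      show "(\<lambda>i\<in>I. \<ominus>\<^bsub>M i\<^esub> x i) i = \<zero>\<^bsub>M i\<^esub>" if "i \<notin> {i \<in> I. x i \<noteq> \<zero>\<^bsub>M i\<^esub>}"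
        using i that by simp
    qed (use x in \<open>auto simp: fin\<close>)
    show "\<exists>y\<in>carrier ?D. y \<oplus>\<^bsub>?D\<^esub> x = \<zero>\<^bsub>?D\<^esub>"
    proof (rule bexI[OF _ inv], rule direct_sum_eqI[OF add[OF inv x] zero])
      fix i assume i: "i \<in> I"
      interpret module K "M i" by (rule module_M) fact
      show "((\<lambda>i\<in>I. \<ominus>\<^bsub>M i\<^esub> x i) \<oplus>\<^bsub>?D\<^esub> x) i = \<zero>\<^bsub>?D\<^esub> i"
        using i x by (simp add: M.l_neg comp)
    qed
  next
    fix x y i assume "x \<in> carrier ?D" "y \<in> carrier ?D" "i \<in> I"
    then show "(x \<oplus>\<^bsub>?D\<^esub> y) i = (y \<oplus>\<^bsub>?D\<^esub> x) i"
      by (simp add: abelian_monoid.a_comm[OF mon] comp)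
  qed (auto simp: zero add smult comp mon_rules abelian_monoid.a_assoc[OF mon]
      module.smult_l_distr[OF module_M] module.smult_r_distr[OF module_M]
      module.smult_assoc1[OF module_M] module.smult_one[OF module_M])
qed

text \<open>Subtraction is no record field but is derived from the additive inverse, so its
  components are found from the additivity of evaluation at \<open>i\<close>. The same holds for
  finite sums below.\<close>

lemma direct_sum_minus:
  assumes "x \<in> carrier (direct_sum I M)" "y \<in> carrier (direct_sum I M)" "i \<in> I"
  shows "(x \<ominus>\<^bsub>direct_sum I M\<^esub> y) i = x i \<ominus>\<^bsub>M i\<^esub> y i"
  using direct_sum_module module_M[OF assms(3)] assms
  by (intro additive_minus[where h = "\<lambda>x. x i"])
    (auto simp: module_def direct_sum_component_closed)

lemma direct_sum_finsum:
  assumes "f \<in> A \<rightarrow> carrier (direct_sum I M)" "i \<in> I"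
  shows "finsum (direct_sum I M) f A i = (\<Oplus>\<^bsub>M i\<^esub>a\<in>A. f a i)"
  using direct_sum_module module_M[OF assms(2)] assms
  by (intro additive_finsum[where h = "\<lambda>x. x i"])
    (auto simp: module_def direct_sum_component_closed)

lemma direct_sum_component_submodule:
  "submodule (direct_sum_component I M n) K (direct_sum I M)"
proof -
  interpret D: module K "direct_sum I M" by (rule direct_sum_module)
  have inv: "(\<ominus>\<^bsub>direct_sum I M\<^esub> x) i = \<zero>\<^bsub>M i\<^esub>"
    if "x \<in> carrier (direct_sum I M)" "i \<in> I" "x i = \<zero>\<^bsub>M i\<^esub>" for x i
  proof -
    interpret module K "M i" by (rule module_M) fact
    have "\<ominus>\<^bsub>direct_sum I M\<^esub> x = \<zero>\<^bsub>direct_sum I M\<^esub> \<ominus>\<^bsub>direct_sum I M\<^esub> x"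
      using that by (simp add: a_minus_def)
    then show ?thesis
      using that direct_sum_minus[of "\<zero>\<^bsub>direct_sum I M\<^esub>" x i] by (simp add: M.r_neg a_minus_def)
  qed
  show ?thesis
    by (rule D.submoduleI)
      (auto simp: direct_sum_component_def inv abelian_monoid.l_zero abelian_monoid.zero_closed
        module.axioms(2)[OF module_M] abelian_group.axioms(1) module.smult_r_null[OF module_M])
qed

end

text \<open>Evaluating a sum of homogeneous elements in arity \<open>d + 1\<close> leaves only the
  term of degree \<open>d\<close>. This forces the terms, and the truncations of \<open>x\<close> to
  single arities realise them.\<close>

lemma direct_sum_unique_decomposition:
  fixes K :: "('k, 'm) ring_scheme" and M :: "nat \<Rightarrow> ('k, 'a) module"
  assumes cring: "cring K" and mod: "\<And>n. module K (M n)"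
    and x: "x \<in> carrier (direct_sum {1..} M)"
  defines "D \<equiv> direct_sum {1..} M"
  shows "\<exists>!f. (\<forall>d. f d \<in> degree_part M d) \<and> finite {d. f d \<noteq> \<zero>\<^bsub>D\<^esub>} \<and>
    x = (\<Oplus>\<^bsub>D\<^esub> d \<in> {d. f d \<noteq> \<zero>\<^bsub>D\<^esub>}. f d)"
proof -
  interpret D: module K D unfolding D_def by (rule direct_sum_module[OF cring mod])
  have M: "abelian_group (M n)" "abelian_monoid (M n)" for n
    using mod[of n] by (auto simp: module_def abelian_group_def)
  have dp: "degree_part M d \<subseteq> carrier D" for d
    by (auto simp: degree_part_def direct_sum_component_def D_def)
  \<comment> \<open>Proved for arbitrary \<open>f\<close> and \<open>x\<close>: existence uses it
    with the sum of the truncations, uniqueness with a competing decomposition.\<close>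
  have comp: "x (Suc d) = f d (Suc d)"
    if f: "\<And>d. f d \<in> degree_part M d" "finite {d. f d \<noteq> \<zero>\<^bsub>D\<^esub>}"
      "x = (\<Oplus>\<^bsub>D\<^esub> d \<in> {d. f d \<noteq> \<zero>\<^bsub>D\<^esub>}. f d)" for f d x
  proof -
    interpret Md: abelian_group "M (Suc d)" by (rule M)
    have fz: "f e (Suc d) = \<zero>\<^bsub>M (Suc d)\<^esub>" if "e \<noteq> d" for e
      using f(1)[of e] that by (auto simp: degree_part_def direct_sum_component_def)
    have fc: "f e (Suc d) \<in> carrier (M (Suc d))" for e
      by (rule direct_sum_component_closed[where I = "{1..}" and M = M])
        (use f(1) dp D_def in auto)
    have "x (Suc d) = (\<Oplus>\<^bsub>M (Suc d)\<^esub> e \<in> {e. f e \<noteq> \<zero>\<^bsub>D\<^esub>}. f e (Suc d))"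
      unfolding f(3) unfolding D_def
      by (rule direct_sum_finsum[OF cring mod]) (use f(1) dp D_def in auto)
    also have "\<dots> = f d (Suc d)"
    \<comment> \<open>If \<open>f d\<close> vanishes, then \<open>d\<close> is missing from the
      index set of the sum, and both sides are zero.\<close>
    proof (cases "f d = \<zero>\<^bsub>D\<^esub>")
      case True
      then show ?thesis
        by (simp add: D_def, intro Md.add.finprod_one_eqI) (auto intro: fz)
    next
      case False
      have "(\<Oplus>\<^bsub>M (Suc d)\<^esub> e \<in> {e. f e \<noteq> \<zero>\<^bsub>D\<^esub>}. f e (Suc d)) =
        (\<Oplus>\<^bsub>M (Suc d)\<^esub> e \<in> {e. f e \<noteq> \<zero>\<^bsub>D\<^esub>}. if d = e then f e (Suc d) else \<zero>\<^bsub>M (Suc d)\<^esub>)"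
        by (intro Md.finsum_cong') (auto simp: fz fc)
      also have "\<dots> = f d (Suc d)"
        using False f(2) by (intro Md.finsum_singleton) (auto simp: fc)
      finally show ?thesis .
    qed
    finally show ?thesis .
  qed
  define F where "F d = (\<lambda>n\<in>{1..}. if n = Suc d then x n else \<zero>\<^bsub>M n\<^esub>)" for d
  have F: "F d \<in> degree_part M d" for d
  proof -
    have "F d \<in> carrier D" unfolding D_def
      by (rule direct_sum_carrierI[where S = "{Suc d}"])
        (use x in \<open>auto simp: F_def abelian_monoid.zero_closed[OF M(2)]
          direct_sum_component_closed[OF x]\<close>)
    then show ?thesis
      by (auto simp: F_def degree_part_def direct_sum_component_def D_def)
  qed
  have finF: "finite {d. F d \<noteq> \<zero>\<^bsub>D\<^esub>}"
  proof -
    \<comment> \<open>The shift by one turns the arity of a nonzero component into its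
      degree.\<close>
    have "{d. F d \<noteq> \<zero>\<^bsub>D\<^esub>} \<subseteq> (\<lambda>n. n - 1) ` {n \<in> {1..}. x n \<noteq> \<zero>\<^bsub>M n\<^esub>}"
    proof
      fix d assume "d \<in> {d. F d \<noteq> \<zero>\<^bsub>D\<^esub>}"
      moreover have "F d = \<zero>\<^bsub>D\<^esub>" if "x (Suc d) = \<zero>\<^bsub>M (Suc d)\<^esub>"
        using that by (auto simp: F_def D_def direct_sum_def)
      ultimately have "x (Suc d) \<noteq> \<zero>\<^bsub>M (Suc d)\<^esub>" by blast
      then show "d \<in> (\<lambda>n. n - 1) ` {n \<in> {1..}. x n \<noteq> \<zero>\<^bsub>M n\<^esub>}"
        by (intro image_eqI[of _ _ "Suc d"]) auto
    qed
    then show ?thesis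
      using x finite_subset by (auto simp: direct_sum_def)
  qed
  show ?thesis
  proof (rule ex1I[of _ F])
    let ?s = "\<Oplus>\<^bsub>D\<^esub> d \<in> {d. F d \<noteq> \<zero>\<^bsub>D\<^esub>}. F d"
    have s: "?s \<in> carrier D" by (rule D.M.finsum_closed) (use F dp in auto)
    have "x = ?s"
    proof (rule direct_sum_eqI[where I = "{1..}" and M = M, OF x s[unfolded D_def], folded D_def])
      fix n :: nat assume "n \<in> {1..}"
      then obtain d where d: "n = Suc d" by (cases n) auto
      have "?s (Suc d) = F d (Suc d)" by (rule comp[OF F finF refl])
      also have "F d (Suc d) = x (Suc d)" by (simp add: F_def)
      finally show "x n = ?s n" by (simp add: d)
    qed
    then show "(\<forall>d. F d \<in> degree_part M d) \<and> finite {d. F d \<noteq> \<zero>\<^bsub>D\<^esub>} \<and> x = ?s"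
      using F finF by blast
  next
    fix f assume f: "(\<forall>d. f d \<in> degree_part M d) \<and> finite {d. f d \<noteq> \<zero>\<^bsub>D\<^esub>} \<and>
      x = (\<Oplus>\<^bsub>D\<^esub> d \<in> {d. f d \<noteq> \<zero>\<^bsub>D\<^esub>}. f d)"
    show "f = F"
    proof
      fix d
      have fd: "f d \<in> degree_part M d" using f by blast
      show "f d = F d"
      proof (rule direct_sum_eqI)
        show "f d \<in> carrier (direct_sum {1..} M)" "F d \<in> carrier (direct_sum {1..} M)"
          using fd F dp D_def by blast+
        fix n :: nat assume n: "n \<in> {1..}"
        show "f d n = F d n"
        proof (cases "n = Suc d")
          case True
          have "x (Suc d) = f d (Suc d)" by (rule comp) (use f in auto)
          then show ?thesis using True by (simp add: F_def)
        next
          case False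
          then show ?thesis using fd n by (simp add: F_def degree_part_def direct_sum_component_def)
        qed
      qed
    qed
  qed
qed

subsection \<open>Quotient modules\<close>

lemma (in module) submodule_abelian_subgroup:
  "submodule H R M \<Longrightarrow> abelian_subgroup H M"
  by (intro abelian_subgroupI3 additive_subgroup.intro M.abelian_group_axioms)
    (rule submodule.axioms(1))

lemma (in module) coset_eq_iff:
  assumes H: "submodule H R M" and xy: "x \<in> carrier M" "y \<in> carrier M"
  shows "H +>\<^bsub>M\<^esub> x = H +>\<^bsub>M\<^esub> y \<longleftrightarrow> x \<ominus>\<^bsub>M\<^esub> y \<in> H"
proof -
  have sub: "subgroup H (add_monoid M)" "H \<subseteq> carrier M"
    using submodule.axioms(1)[OF H] submoduleE(1)[OF H] by auto
  show ?thesis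
  proof
    assume "H +>\<^bsub>M\<^esub> x = H +>\<^bsub>M\<^esub> y"
    then show "x \<ominus>\<^bsub>M\<^esub> y \<in> H"
      using M.a_coset_add_inv2[OF _ xy sub(2)] M.a_coset_join1[OF _ _ sub(1)] xy
      by (simp add: a_minus_def)
  next
    assume "x \<ominus>\<^bsub>M\<^esub> y \<in> H"
    then show "H +>\<^bsub>M\<^esub> x = H +>\<^bsub>M\<^esub> y"
      using M.a_coset_add_inv1[OF _ xy sub(2)] M.a_coset_join2[OF _ sub(1)] xy
      by (simp add: a_minus_def)
  qed
qed

context
  fixes R :: "('k, 'm) ring_scheme" and M :: "('k, 'a) module"
  assumes module_RM: "module R M"
begin

interpretation module R M by (rule module_RM)

text \<open>Reduces the operations on cosets to representatives. The scalar multiple is defined as a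
  union over all elements of a coset, so it has to be shown that each of them contributes the same
  coset.\<close>

lemma quotient_module_sel:
  assumes H: "submodule H R M"
  shows "carrier (quotient_module M H) = (\<lambda>x. H +>\<^bsub>M\<^esub> x) ` carrier M"
    and "\<zero>\<^bsub>quotient_module M H\<^esub> = H"
    and "\<lbrakk>x \<in> carrier M; y \<in> carrier M\<rbrakk> \<Longrightarrow>
      (H +>\<^bsub>M\<^esub> x) \<oplus>\<^bsub>quotient_module M H\<^esub> (H +>\<^bsub>M\<^esub> y) = H +>\<^bsub>M\<^esub> (x \<oplus>\<^bsub>M\<^esub> y)"
    and "\<lbrakk>a \<in> carrier R; x \<in> carrier M\<rbrakk> \<Longrightarrow>
      a \<odot>\<^bsub>quotient_module M H\<^esub> (H +>\<^bsub>M\<^esub> x) = H +>\<^bsub>M\<^esub> (a \<odot>\<^bsub>M\<^esub> x)"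
proof -
  interpret H: abelian_subgroup H M by (rule submodule_abelian_subgroup[OF H])
  show "carrier (quotient_module M H) = (\<lambda>x. H +>\<^bsub>M\<^esub> x) ` carrier M"
    by (auto simp: quotient_module_def A_RCOSETS_def')
  show "\<zero>\<^bsub>quotient_module M H\<^esub> = H"
    by (simp add: quotient_module_def)
  show "(H +>\<^bsub>M\<^esub> x) \<oplus>\<^bsub>quotient_module M H\<^esub> (H +>\<^bsub>M\<^esub> y) = H +>\<^bsub>M\<^esub> (x \<oplus>\<^bsub>M\<^esub> y)"
    if "x \<in> carrier M" "y \<in> carrier M"
    using that by (simp add: quotient_module_def H.a_rcos_sum)
  show "a \<odot>\<^bsub>quotient_module M H\<^esub> (H +>\<^bsub>M\<^esub> x) = H +>\<^bsub>M\<^esub> (a \<odot>\<^bsub>M\<^esub> x)"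
    if a: "a \<in> carrier R" and x: "x \<in> carrier M"
  proof -
    have "H +>\<^bsub>M\<^esub> (a \<odot>\<^bsub>M\<^esub> y) = H +>\<^bsub>M\<^esub> (a \<odot>\<^bsub>M\<^esub> x)" if "y \<in> H +>\<^bsub>M\<^esub> x" for y
    proof -
      have y: "y \<in> carrier M" using H.a_elemrcos_carrier[OF x that] .
      have "H +>\<^bsub>M\<^esub> y = H +>\<^bsub>M\<^esub> x"
        using H.a_repr_independence'[OF that x] by simp
      then have "y \<ominus>\<^bsub>M\<^esub> x \<in> H" using coset_eq_iff[OF H y x] by simp
      then have "a \<odot>\<^bsub>M\<^esub> (y \<ominus>\<^bsub>M\<^esub> x) \<in> H" using submoduleE(4)[OF H a] by simp
      moreover have "a \<odot>\<^bsub>M\<^esub> (y \<ominus>\<^bsub>M\<^esub> x) = a \<odot>\<^bsub>M\<^esub> y \<ominus>\<^bsub>M\<^esub> a \<odot>\<^bsub>M\<^esub> x"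
        using a x y by (simp add: a_minus_def smult_r_distr smult_r_minus)
      ultimately show ?thesis using coset_eq_iff[OF H] a x y by simp
    qed
    moreover have "x \<in> H +>\<^bsub>M\<^esub> x" using H.a_rcos_self[OF x] .
    ultimately have "(\<Union>y\<in>H +>\<^bsub>M\<^esub> x. H +>\<^bsub>M\<^esub> (a \<odot>\<^bsub>M\<^esub> y)) = H +>\<^bsub>M\<^esub> (a \<odot>\<^bsub>M\<^esub> x)"
      by blast
    then show ?thesis by (simp add: quotient_module_def)
  qed
qed

lemma quotient_module_module:
  assumes H: "submodule H R M"
  shows "module R (quotient_module M H)"
proof -
  note sel = quotient_module_sel[OF H]
  \<comment> \<open>With zero also written as a coset of a representative, every module law follows
    from the same law in \<open>M\<close>.\<close>
  have zero: "\<zero>\<^bsub>quotient_module M H\<^esub> = H +>\<^bsub>M\<^esub> \<zero>\<^bsub>M\<^esub>"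
    using submoduleE(1)[OF H] by (simp add: sel(2))
  show ?thesis
  proof (intro moduleI abelian_groupI R.is_cring)
    fix X assume "X \<in> carrier (quotient_module M H)"
    then obtain x where x: "x \<in> carrier M" "X = H +>\<^bsub>M\<^esub> x" by (auto simp: sel(1))
    show "\<exists>Y\<in>carrier (quotient_module M H).
        Y \<oplus>\<^bsub>quotient_module M H\<^esub> X = \<zero>\<^bsub>quotient_module M H\<^esub>"
      by (rule bexI[of _ "H +>\<^bsub>M\<^esub> (\<ominus>\<^bsub>M\<^esub> x)"]) (use x in \<open>auto simp: zero sel(1,3) M.l_neg\<close>)
  qed (auto simp: zero sel(1,3,4) M.a_ac smult_l_distr smult_r_distr smult_assoc1)
qed

lemma submodule_Inter:
  assumes "\<And>H. H \<in> \<H> \<Longrightarrow> submodule H R M" "\<H> \<noteq> {}"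
  shows "submodule (\<Inter>\<H>) R M"
proof (rule submoduleI)
  note sub = submoduleE[OF assms(1)]
  show "\<Inter>\<H> \<subseteq> carrier M" using assms(2) sub(1) by blast
  show "\<zero>\<^bsub>M\<^esub> \<in> \<Inter>\<H>"
    using subgroup.one_closed[OF submodule.axioms(1)[OF assms(1)]] by simp
  show "\<ominus>\<^bsub>M\<^esub> x \<in> \<Inter>\<H>" if "x \<in> \<Inter>\<H>" for x
    using that sub(3) by blast
  show "x \<oplus>\<^bsub>M\<^esub> y \<in> \<Inter>\<H>" if "x \<in> \<Inter>\<H>" "y \<in> \<Inter>\<H>" for x y
    using that sub(5) by blast
  show "a \<odot>\<^bsub>M\<^esub> x \<in> \<Inter>\<H>" if "a \<in> carrier R" "x \<in> \<Inter>\<H>" for a x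
    using that sub(4) by blast
qed

text \<open>The whole carrier is a submodule containing \<open>S\<close>, so the family that is
  intersected is not empty.\<close>

lemma
  assumes "S \<subseteq> carrier M"
  shows vect_submodule: "submodule (vect R M S) R M"
    and vect_incl: "S \<subseteq> vect R M S"
  using assms carrier_is_submodule
  by (auto simp: vect_def intro!: submodule_Inter)

end

lemma vect_least: "submodule H K M \<Longrightarrow> S \<subseteq> H \<Longrightarrow> vect K M S \<subseteq> H"
  by (auto simp: vect_def)

subsection \<open>Block permutations\<close>

lemma block_start_Suc: "j < length ks \<Longrightarrow> block_start ks (Suc j) = block_start ks j + ks ! j"
  by (simp add: block_start_def take_Suc_conv_app_nth)

lemma block_start_mono: "i \<le> j \<Longrightarrow> block_start ks i \<le> block_start ks j"
  unfolding block_start_def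
  by (metis le_add1 le_add_diff_inverse sum_list_append take_add)

lemma block_start_add_less:
  assumes "j < length ks" "t < ks ! j"
  shows "block_start ks j + t < sum_list ks"
proof -
  have "block_start ks (Suc j) \<le> block_start ks (length ks)"
    using assms by (intro block_start_mono) simp
  then show ?thesis using assms by (simp add: block_start_Suc) (simp add: block_start_def)
qed

text \<open>An empty block ends where it starts, so the strict comparison with the end of a block
  passes over it; the least block that qualifies is the one that really contains the
  position.\<close>

lemma block_of_block_start:
  assumes "j < length ks" "t < ks ! j"
  shows "block_of ks (block_start ks j + t) = j"
  unfolding block_of_def
proof (rule Least_equality)
  show "block_start ks j + t < block_start ks (Suc j)" using assms by (simp add: block_start_Suc)
  fix i assume "block_start ks j + t < block_start ks (Suc i)"
  then show "j \<le> i" using block_start_mono[of "Suc i" j ks] by (meson leD le_add1 le_trans not_less_eq_eq)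
qed

lemma block_decomposition:
  assumes "m < sum_list ks"
  obtains j t where "j < length ks" "t < ks ! j" "m = block_start ks j + t"
proof
  let ?j = "block_of ks m"
  \<comment> \<open>\<open>take\<close> past the end returns the whole list, so
    \<open>length ks\<close> witnesses the \<open>LEAST\<close> in \<open>block_of\<close>.\<close>
  have "m < block_start ks (Suc (length ks))" using assms by (simp add: block_start_def)
  then have upper: "m < block_start ks (Suc ?j)" unfolding block_of_def by (rule LeastI)
  \<comment> \<open>By minimality of the block number, its predecessor ends at or before
    \<open>m\<close>.\<close>
  have lower: "block_start ks ?j \<le> m"
  proof (cases ?j)
    case 0
    then show ?thesis by (simp add: block_start_def)
  next
    case (Suc i)
    then have "\<not> m < block_start ks (Suc i)"
      using not_less_Least[of i "\<lambda>j. m < block_start ks (Suc j)"] by (simp add: block_of_def)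
    then show ?thesis by (simp add: Suc)
  qed
  show len: "?j < length ks"
  proof (rule ccontr)
    assume "\<not> ?j < length ks"
    then have "block_start ks ?j = sum_list ks" by (simp add: block_start_def)
    then show False using lower assms by simp
  qed
  show "m - block_start ks ?j < ks ! ?j" "m = block_start ks ?j + (m - block_start ks ?j)"
    using upper lower len by (auto simp: block_start_Suc)
qed

text \<open>Common source for both kinds of block permutation: block \<open>j\<close> of
  \<open>ks\<close> goes to block \<open>\<sigma> j\<close> of a rearranged list \<open>ks'\<close>,
  with \<open>\<tau> j\<close> acting inside. Block number and offset can be recovered from the
  image, so the map is injective, hence bijective on a finite set.\<close>

lemma blockwise_permutes:
  assumes \<sigma>: "\<sigma> permutes {..<length ks}" and \<tau>: "\<And>j. j < length ks \<Longrightarrow> \<tau> j permutes {..<ks ! j}"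
    and ks': "length ks' = length ks" "\<And>j. j < length ks \<Longrightarrow> ks' ! \<sigma> j = ks ! j"
      "sum_list ks' = sum_list ks"
    and outside: "\<And>m. m \<ge> sum_list ks \<Longrightarrow> f m = m"
    and inside: "\<And>j t. j < length ks \<Longrightarrow> t < ks ! j \<Longrightarrow>
      f (block_start ks j + t) = block_start ks' (\<sigma> j) + \<tau> j t"
  shows "f permutes {..<sum_list ks}"
proof (rule bij_imp_permutes)
  have \<sigma>': "\<sigma> j < length ks'" if "j < length ks" for j
    using permutes_in_image[OF \<sigma>, of j] that ks' by simp
  have \<tau>': "\<tau> j t < ks' ! \<sigma> j" if "j < length ks" "t < ks ! j" for j t
    using permutes_in_image[OF \<tau>, of j t] that ks' by simp
  have "f ` {..<sum_list ks} \<subseteq> {..<sum_list ks}"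
  proof
    fix m' assume "m' \<in> f ` {..<sum_list ks}"
    then obtain m where m: "m < sum_list ks" "m' = f m" by auto
    from block_decomposition[OF m(1)] obtain j t
      where j: "j < length ks" "t < ks ! j" "m = block_start ks j + t" .
    then have "m' < sum_list ks'"
      using block_start_add_less[OF \<sigma>' \<tau>', OF j(1) j(1,2)] by (simp add: m inside)
    then show "m' \<in> {..<sum_list ks}" by (simp add: ks')
  qed
  moreover have "inj_on f {..<sum_list ks}"
  proof (rule inj_onI)
    fix m m' assume "m \<in> {..<sum_list ks}" "m' \<in> {..<sum_list ks}" and eq: "f m = f m'"
    then have m: "m < sum_list ks" "m' < sum_list ks" by auto
    from block_decomposition[OF m(1)] obtain j t
      where j: "j < length ks" "t < ks ! j" "m = block_start ks j + t" .
    from block_decomposition[OF m(2)] obtain j' t'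
      where j': "j' < length ks" "t' < ks ! j'" "m' = block_start ks j' + t'" .
    have *: "block_start ks' (\<sigma> j) + \<tau> j t = block_start ks' (\<sigma> j') + \<tau> j' t'"
      using eq j j' by (simp add: inside)
    \<comment> \<open>Both sides name the same position, so \<open>block_of ks'\<close> gives the
      same block number for them.\<close>
    then have "\<sigma> j = \<sigma> j'"
      using block_of_block_start[OF \<sigma>' \<tau>', OF j(1) j(1,2)]
        block_of_block_start[OF \<sigma>' \<tau>', OF j'(1) j'(1,2)] by simp
    then have "j = j'" using permutes_inj[OF \<sigma>] by (meson injD)
    moreover from this have "t = t'"
      using * permutes_inj[OF \<tau>[OF j(1)]] by (auto dest: injD)
    ultimately show "m = m'" using j j' by simp
  qed
  ultimately show "bij_betw f {..<sum_list ks} {..<sum_list ks}"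
    by (simp add: bij_betw_def endo_inj_surj)
qed (use outside in auto)

text \<open>The equivariance axioms mention these maps without saying that they are permutations;
  this is needed before the relations of the coinvariants can be applied to them.\<close>

lemma block_sum_permutes:
  assumes "list_all2 (\<lambda>k \<tau>. \<tau> permutes {..<k}) ks \<tau>s"
  shows "block_sum ks \<tau>s permutes {..<sum_list ks}"
proof (rule blockwise_permutes[where \<sigma> = id and \<tau> = "\<lambda>j. \<tau>s ! j" and ks' = ks])
  show "block_sum ks \<tau>s (block_start ks j + t) = block_start ks (id j) + (\<tau>s ! j) t"
    if "j < length ks" "t < ks ! j" for j t
    using that by (simp add: block_sum_def block_of_block_start block_start_add_less)
qed (use assms in \<open>auto simp: list_all2_conv_all_nth block_sum_def permutes_id\<close>)

lemma block_perm_permutes: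
  assumes \<sigma>: "\<sigma> permutes {..<length ks}"
  shows "block_perm ks \<sigma> permutes {..<sum_list ks}"
proof (rule blockwise_permutes[OF \<sigma>, where \<tau> = "\<lambda>j. id" and ks' = "permute_list (inv_into UNIV \<sigma>) ks"])
  have inv: "inv_into UNIV \<sigma> permutes {..<length ks}" by (rule permutes_inv[OF \<sigma>])
  \<comment> \<open>The list is permuted by the inverse of \<open>\<sigma>\<close>, so its entry at
    \<open>\<sigma> j\<close> is the old entry at \<open>j\<close>.\<close>
  show "permute_list (inv_into UNIV \<sigma>) ks ! \<sigma> j = ks ! j" if "j < length ks" for j
    using that permutes_in_image[OF \<sigma>, of j] inv
    by (simp add: permute_list_nth permutes_inverses(2)[OF \<sigma>])
  show "sum_list (permute_list (inv_into UNIV \<sigma>) ks) = sum_list ks"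
    by (metis inv mset_permute_list sum_mset_sum_list)
  show "block_perm ks \<sigma> (block_start ks j + t) =
      block_start (permute_list (inv_into UNIV \<sigma>) ks) (\<sigma> j) + id t"
    if "j < length ks" "t < ks ! j" for j t
    using that by (simp add: block_perm_def block_of_block_start block_start_add_less)
qed (auto simp: block_perm_def permutes_id)

subsection \<open>Insertions at one and at two inputs\<close>

text \<open>Locates, after flattening, the one entry that differs from the pattern of units; both
  insertion lemmas below are instances.\<close>

lemma concat_list_update_element:
  assumes "j < length xss" "xss ! j = ys" "t < length ys"
  shows "concat (xss[j := ys[t := b]]) = (concat xss)[length (concat (take j xss)) + t := b]"
  using assms
proof (induction xss arbitrary: j)
  case (Cons xs xss)
  then show ?case
    by (cases j) (auto simp: list_update_append1 list_update_append)
qed simp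

lemma concat_singletons_update:
  "i < n \<Longrightarrow> concat ((replicate n [a])[i := replicate m a]) = replicate (n + m - 1) a"
proof (induction n arbitrary: i)
  case (Suc n)
  have "concat (replicate k [a]) = replicate k a" for k by (induction k) auto
  with Suc show ?case
    by (cases i; cases n) (simp_all add: replicate_add[symmetric] replicate_app_Cons_same add.commute)
qed simp

text \<open>Polymorphic in the entries, because the list of arities and the list of operations have
  to be flattened to matching positions.\<close>

lemma concat_insert_inside:
  assumes "i < n" "t < m"
  shows "concat ((replicate n [a])[i := (replicate m a)[t := b]]) = (replicate (n + m - 1) a)[i + t := b]"
proof -
  have "concat (replicate k [a]) = replicate k a" for k by (induction k) auto
  then show ?thesis
    using concat_list_update_element[of i "(replicate n [a])[i := replicate m a]" "replicate m a" t b]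
      concat_singletons_update[of i n a m] assms by (simp add: min_def)
qed

lemma concat_insert_outside:
  assumes "i < n" "j < n" "i \<noteq> j" "m > 0"
  shows "concat ((replicate n [a])[i := replicate m a, j := [b]]) =
    (replicate (n + m - 1) a)[(if j < i then j else j + m - 1) := b]"
proof -
  have "concat (replicate k [a]) = replicate k a" for k by (induction k) auto
  \<comment> \<open>The first \<open>j\<close> blocks contain the long block exactly when
    \<open>i < j\<close>; only then is the position of \<open>b\<close> shifted by
    \<open>m - 1\<close>.\<close>
  moreover have "take j ((replicate n [a])[i := replicate m a]) =
      (if j < i then replicate j [a] else (replicate j [a])[i := replicate m a])"
    using assms by (simp add: take_update_swap min_def list_update_beyond)
  ultimately have "length (concat (take j ((replicate n [a])[i := replicate m a]))) =
      (if j < i then j else j + m - 1)"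
    using assms concat_singletons_update[of i j a m] by simp
  then show ?thesis
    using concat_list_update_element[of j "(replicate n [a])[i := replicate m a]" "[a]" 0 b]
      concat_singletons_update[of i n a m] assms by simp
qed

lemma sum_list_ones_update: "i < n \<Longrightarrow> sum_list ((replicate n (1::nat))[i := m]) = n + m - 1"
  by (simp add: sum_list_update sum_list_replicate)

lemma sum_list_ones_update2:
  assumes "i < n" "j < n" "i \<noteq> j"
  shows "sum_list ((replicate n (1::nat))[i := m, j := k]) = n + m + k - 2"
  using assms by (simp add: sum_list_update sum_list_replicate)

section \<open>Partial compositions and simultaneous insertions in an operad\<close>

context operad
begin

sublocale P: module K "P n" for n
  by (rule module_P)

abbreviation pc where "pc \<equiv> partial_comp \<gamma> I"

abbreviation bul where "bul \<equiv> bullet P \<gamma> I"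

definition double_comp :: "nat \<Rightarrow> nat \<Rightarrow> nat \<Rightarrow> nat \<Rightarrow> nat \<Rightarrow> 'a \<Rightarrow> 'a \<Rightarrow> 'a \<Rightarrow> 'a" where
  "double_comp n i m j k p q r =
    \<gamma> ((replicate n 1)[i := m, j := k]) p ((replicate n I)[i := q, j := r])"

lemma tuple_in_units: "tuple_in P (replicate n 1) (replicate n I)"
  using unit_closed by (simp add: list_all2_conv_all_nth)

lemma tuple_in_update:
  "tuple_in P ks qs \<Longrightarrow> q \<in> carrier (P m) \<Longrightarrow> tuple_in P (ks[i := m]) (qs[i := q])"
  by (rule list_all2_update_cong)

lemmas tuple_in_intros = tuple_in_units tuple_in_update

lemma partial_comp_closed:
  assumes "i < n" "p \<in> carrier (P n)" "q \<in> carrier (P m)"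
  shows "pc n m i p q \<in> carrier (P (n + m - 1))"
  using comp_closed[of p "(replicate n 1)[i := m]" "(replicate n I)[i := q]"]
    sum_list_ones_update[of i n m] assms tuple_in_update[OF tuple_in_units assms(3), of n i]
  by (simp add: partial_comp_def)

lemma partial_comp_add_l:
  assumes "i < n" "p \<in> carrier (P n)" "p' \<in> carrier (P n)" "q \<in> carrier (P m)"
  shows "pc n m i (p \<oplus>\<^bsub>P n\<^esub> p') q = pc n m i p q \<oplus>\<^bsub>P (n + m - 1)\<^esub> pc n m i p' q"
  using comp_add_l[of p "(replicate n 1)[i := m]" p' "(replicate n I)[i := q]"]
    sum_list_ones_update[of i n m] assms tuple_in_update[OF tuple_in_units assms(4), of n i]
  by (simp add: partial_comp_def)

lemma partial_comp_smult_l: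
  assumes "i < n" "a \<in> carrier K" "p \<in> carrier (P n)" "q \<in> carrier (P m)"
  shows "pc n m i (a \<odot>\<^bsub>P n\<^esub> p) q = a \<odot>\<^bsub>P (n + m - 1)\<^esub> pc n m i p q"
  using comp_smult_l[of a p "(replicate n 1)[i := m]" "(replicate n I)[i := q]"]
    sum_list_ones_update[of i n m] assms tuple_in_update[OF tuple_in_units assms(4), of n i]
  by (simp add: partial_comp_def)

lemma partial_comp_add_r:
  assumes "i < n" "p \<in> carrier (P n)" "q \<in> carrier (P m)" "q' \<in> carrier (P m)"
  shows "pc n m i p (q \<oplus>\<^bsub>P m\<^esub> q') = pc n m i p q \<oplus>\<^bsub>P (n + m - 1)\<^esub> pc n m i p q'"
  using comp_add_r[of p "(replicate n 1)[i := m]" "(replicate n I)[i := q]" i q q']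
    sum_list_ones_update[of i n m] assms tuple_in_update[OF tuple_in_units assms(3), of n i]
  by (simp add: partial_comp_def)

lemma partial_comp_smult_r:
  assumes "i < n" "a \<in> carrier K" "p \<in> carrier (P n)" "q \<in> carrier (P m)"
  shows "pc n m i p (a \<odot>\<^bsub>P m\<^esub> q) = a \<odot>\<^bsub>P (n + m - 1)\<^esub> pc n m i p q"
  using comp_smult_r[of a p "(replicate n 1)[i := m]" "(replicate n I)[i := q]" i q]
    sum_list_ones_update[of i n m] assms tuple_in_update[OF tuple_in_units assms(4), of n i]
  by (simp add: partial_comp_def)

lemma double_comp_closed:
  assumes "i < n" "j < n" "i \<noteq> j" "p \<in> carrier (P n)" "q \<in> carrier (P m)" "r \<in> carrier (P k)"
  shows "double_comp n i m j k p q r \<in> carrier (P (n + m + k - 2))"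
  using comp_closed[of p "(replicate n 1)[i := m, j := k]" "(replicate n I)[i := q, j := r]"]
    sum_list_ones_update2[of i n j m k] assms
    tuple_in_update[OF tuple_in_update[OF tuple_in_units assms(5)] assms(6), of n i j]
  by (simp add: double_comp_def)

text \<open>List updates at distinct positions commute. This is the source of the symmetry in the
  pre-Lie identity.\<close>

lemma double_comp_swap:
  "i \<noteq> j \<Longrightarrow> double_comp n i m j k p q r = double_comp n j k i m p r q"
  by (simp add: double_comp_def list_update_swap)

lemma list_all2_tuple_in_units: "list_all2 (tuple_in P) (replicate n [1]) (replicate n [I])"
  using unit_closed by (simp add: list_all2_conv_all_nth)

text \<open>The sequential law \<open>(p \<circ>\<^sub>i q) \<circ> r = p \<circ>\<^sub>i (q
  \<circ>\<^sub>t r)\<close>, with \<open>r\<close> in position \<open>i + t\<close> on the left: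
  full associativity with units in all inputs of \<open>p\<close> except \<open>i\<close> and all
  inputs of \<open>q\<close> except \<open>t\<close>.\<close>

lemma comp_comp_inside:
  assumes "i < n" "t < m" "p \<in> carrier (P n)" "q \<in> carrier (P m)" "r \<in> carrier (P k)"
  shows "pc (n + m - 1) k (i + t) (pc n m i p q) r = pc n (m + k - 1) i p (pc m k t q r)"
proof -
  \<comment> \<open>Entry \<open>j\<close> of \<open>kss\<close> lists the arities inserted above
    input \<open>j\<close> of \<open>p\<close>: a single unit, except above \<open>i\<close>, where
    \<open>q\<close> receives \<open>r\<close> at its input \<open>t\<close>.\<close>
  define kss where "kss = (replicate n [1::nat])[i := (replicate m 1)[t := k]]"
  define rss where "rss = (replicate n [I])[i := (replicate m I)[t := r]]"
  define qs where "qs = (replicate n I)[i := q]"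
  have len: "map length kss = (replicate n 1)[i := m]"
    and sum: "map sum_list kss = (replicate n 1)[i := m + k - 1]"
    using sum_list_ones_update[OF assms(2), of k] by (simp_all add: kss_def map_update)
  have [simp]: "length kss = n" by (simp add: kss_def)
  have tup: "tuple_in P (map length kss) qs"
    unfolding len qs_def by (intro tuple_in_intros assms)
  have "tuple_in P ((replicate m 1)[t := k]) ((replicate m I)[t := r])"
    by (intro tuple_in_intros assms)
  from list_all2_update_cong[OF list_all2_tuple_in_units this]
  have "list_all2 (tuple_in P) kss rss" unfolding kss_def rss_def .
  note assoc = comp_assoc[OF _ tup this, of p]
  \<comment> \<open>Away from \<open>i\<close> a unit is composed with a unit; at \<open>i\<close>
    the partial composition of \<open>q\<close> and \<open>r\<close> appears.\<close>
  have vals: "map (\<lambda>j. \<gamma> (kss ! j) (qs ! j) (rss ! j)) [0..<length kss] =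
      (replicate n I)[i := pc m k t q r]"
  proof (rule nth_equalityI)
    fix j assume "j < length (map (\<lambda>j. \<gamma> (kss ! j) (qs ! j) (rss ! j)) [0..<length kss])"
    then have "j < n" by simp
    then show "map (\<lambda>j. \<gamma> (kss ! j) (qs ! j) (rss ! j)) [0..<length kss] ! j =
        (replicate n I)[i := pc m k t q r] ! j"
      using unit_l[OF unit_closed] assms(1)
      by (cases "j = i") (simp_all add: kss_def rss_def qs_def partial_comp_def)
  qed simp
  have "concat kss = (replicate (n + m - 1) 1)[i + t := k]"
    "concat rss = (replicate (n + m - 1) I)[i + t := r]"
    unfolding kss_def rss_def using assms by (simp_all only: concat_insert_inside)
  then show ?thesis
    using assoc assms(3) unfolding len sum vals by (simp add: partial_comp_def qs_def)
qed

text \<open>Full associativity once more: \<open>r\<close> reaches input \<open>j\<close> of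
  \<open>p\<close> through the unit sitting there. The composite is therefore a simultaneous
  insertion that no longer remembers which of \<open>q\<close> and \<open>r\<close> came
  first.\<close>

lemma comp_comp_outside:
  assumes "i < n" "j < n" "i \<noteq> j" "m > 0"
    and "p \<in> carrier (P n)" "q \<in> carrier (P m)" "r \<in> carrier (P k)"
  shows "pc (n + m - 1) k (if j < i then j else j + m - 1) (pc n m i p q) r =
    double_comp n i m j k p q r"
proof -
  define kss where "kss = (replicate n [1::nat])[i := replicate m 1, j := [k]]"
  define rss where "rss = (replicate n [I])[i := replicate m I, j := [r]]"
  define qs where "qs = (replicate n I)[i := q]"
  \<comment> \<open>The block \<open>[k]\<close> at \<open>j\<close> has length 1, the arity of the
    unit, so it leaves the list of lengths unchanged.\<close>
  have "(replicate n (1::nat))[i := m, j := 1] = (replicate n 1)[i := m]"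
    using assms by (metis length_replicate list_update_id nth_list_update_neq nth_replicate)
  then have len: "map length kss = (replicate n 1)[i := m]"
    by (simp add: kss_def map_update)
  have sum: "map sum_list kss = (replicate n 1)[i := m, j := k]"
    by (simp add: kss_def map_update sum_list_replicate)
  have [simp]: "length kss = n" by (simp add: kss_def)
  have tup: "tuple_in P (map length kss) qs"
    unfolding len qs_def by (intro tuple_in_intros assms)
  have "tuple_in P [k] [r]" using assms by simp
  then have "list_all2 (tuple_in P) kss rss"
    unfolding kss_def rss_def
    by (intro list_all2_update_cong list_all2_tuple_in_units tuple_in_units)
  note assoc = comp_assoc[OF _ tup this, of p]
  \<comment> \<open>At \<open>i\<close> the right unit law restores \<open>q\<close>, at
    \<open>j\<close> the left unit law gives \<open>r\<close>, and elsewhere a unit meets a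
    unit.\<close>
  have vals: "map (\<lambda>j. \<gamma> (kss ! j) (qs ! j) (rss ! j)) [0..<length kss] =
      (replicate n I)[i := q, j := r]"
  proof (rule nth_equalityI)
    fix l assume "l < length (map (\<lambda>j. \<gamma> (kss ! j) (qs ! j) (rss ! j)) [0..<length kss])"
    then have "l < n" by simp
    then show "map (\<lambda>j. \<gamma> (kss ! j) (qs ! j) (rss ! j)) [0..<length kss] ! l =
        (replicate n I)[i := q, j := r] ! l"
      using unit_l[OF unit_closed] unit_l[OF assms(7)] unit_r[OF assms(6)] assms(1-3)
      by (cases "l = i"; cases "l = j") (simp_all add: kss_def rss_def qs_def)
  qed simp
  have "concat kss = (replicate (n + m - 1) 1)[(if j < i then j else j + m - 1) := k]"
    "concat rss = (replicate (n + m - 1) I)[(if j < i then j else j + m - 1) := r]"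
    unfolding kss_def rss_def by (rule concat_insert_outside[OF assms(1-4)])+
  then show ?thesis
    using assoc assms(5) unfolding len sum vals
    by (simp add: partial_comp_def double_comp_def qs_def)
qed

subsection \<open>The product in a fixed arity\<close>

context
  notes One_nat_def [simp del]
begin

lemma bullet_closed:
  "p \<in> carrier (P n) \<Longrightarrow> q \<in> carrier (P m) \<Longrightarrow> bul n m p q \<in> carrier (P (n + m - 1))"
  unfolding bullet_def by (rule P.M.finsum_closed) (auto intro: partial_comp_closed)

lemma bullet_add_l:
  assumes "p \<in> carrier (P n)" "p' \<in> carrier (P n)" "q \<in> carrier (P m)"
  shows "bul n m (p \<oplus>\<^bsub>P n\<^esub> p') q = bul n m p q \<oplus>\<^bsub>P (n + m - 1)\<^esub> bul n m p' q"
proof -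
  have "bul n m (p \<oplus>\<^bsub>P n\<^esub> p') q =
      (\<Oplus>\<^bsub>P (n + m - 1)\<^esub>i\<in>{..<n}. pc n m i p q \<oplus>\<^bsub>P (n + m - 1)\<^esub> pc n m i p' q)"
    unfolding bullet_def
    by (rule P.M.finsum_cong')
      (use assms in \<open>auto simp: partial_comp_add_l partial_comp_closed\<close>)
  then show ?thesis
    unfolding bullet_def by (subst (asm) P.M.finsum_addf) (use assms partial_comp_closed in auto)
qed

lemma bullet_add_r:
  assumes "p \<in> carrier (P n)" "q \<in> carrier (P m)" "q' \<in> carrier (P m)"
  shows "bul n m p (q \<oplus>\<^bsub>P m\<^esub> q') = bul n m p q \<oplus>\<^bsub>P (n + m - 1)\<^esub> bul n m p q'"
proof -
  have "bul n m p (q \<oplus>\<^bsub>P m\<^esub> q') =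
      (\<Oplus>\<^bsub>P (n + m - 1)\<^esub>i\<in>{..<n}. pc n m i p q \<oplus>\<^bsub>P (n + m - 1)\<^esub> pc n m i p q')"
    unfolding bullet_def
    by (rule P.M.finsum_cong')
      (use assms in \<open>auto simp: partial_comp_add_r partial_comp_closed\<close>)
  then show ?thesis
    unfolding bullet_def by (subst (asm) P.M.finsum_addf) (use assms partial_comp_closed in auto)
qed

lemma bullet_smult_l:
  assumes "a \<in> carrier K" "p \<in> carrier (P n)" "q \<in> carrier (P m)"
  shows "bul n m (a \<odot>\<^bsub>P n\<^esub> p) q = a \<odot>\<^bsub>P (n + m - 1)\<^esub> bul n m p q"
  unfolding bullet_def
  by (subst P.finsum_smult_ldistr, use assms partial_comp_closed in auto)
    (rule P.M.finsum_cong', use assms in \<open>auto simp: partial_comp_smult_l partial_comp_closed\<close>)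

lemma bullet_smult_r:
  assumes "a \<in> carrier K" "p \<in> carrier (P n)" "q \<in> carrier (P m)"
  shows "bul n m p (a \<odot>\<^bsub>P m\<^esub> q) = a \<odot>\<^bsub>P (n + m - 1)\<^esub> bul n m p q"
  unfolding bullet_def
  by (subst P.finsum_smult_ldistr, use assms partial_comp_closed in auto)
    (rule P.M.finsum_cong', use assms in \<open>auto simp: partial_comp_smult_r partial_comp_closed\<close>)

text \<open>The defect of associativity of \<open>bullet\<close>. The sum is nested, since for fixed
  \<open>i\<close> the inner sum is what inserting \<open>r\<close> into
  \<open>p \<circ>\<^sub>i q\<close> outside of \<open>q\<close> yields.\<close>

definition double_insertion :: "nat \<Rightarrow> nat \<Rightarrow> nat \<Rightarrow> 'a \<Rightarrow> 'a \<Rightarrow> 'a \<Rightarrow> 'a" where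
  "double_insertion n m k p q r =
    (\<Oplus>\<^bsub>P (n + m + k - 2)\<^esub>i\<in>{..<n}. \<Oplus>\<^bsub>P (n + m + k - 2)\<^esub>j\<in>{..<n} - {i}.
      double_comp n i m j k p q r)"

lemma double_insertion_closed:
  assumes "p \<in> carrier (P n)" "q \<in> carrier (P m)" "r \<in> carrier (P k)"
  shows "double_insertion n m k p q r \<in> carrier (P (n + m + k - 2))"
  unfolding double_insertion_def
  by (intro P.M.finsum_closed Pi_I) (use assms double_comp_closed in auto)

lemma double_insertion_swap:
  assumes "p \<in> carrier (P n)" "q \<in> carrier (P m)" "r \<in> carrier (P k)"
  shows "double_insertion n m k p q r = double_insertion n k m p r q"
proof -
  have N: "n + k + m - 2 = n + m + k - 2" by simp
  have "bij_betw prod.swap (SIGMA i:{..<n}. {..<n} - {i}) (SIGMA i:{..<n}. {..<n} - {i})"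
    by (rule bij_betwI[where g = prod.swap]) auto
  then show ?thesis
    unfolding double_insertion_def N
    by (intro P.M.finsum_nested_reindex)
      (use assms in \<open>auto simp: double_comp_closed intro: double_comp_swap\<close>)
qed

lemma bullet_finsum_l:
  assumes "f \<in> A \<rightarrow> carrier (P n)" "q \<in> carrier (P m)"
  shows "bul n m (\<Oplus>\<^bsub>P n\<^esub>a\<in>A. f a) q = (\<Oplus>\<^bsub>P (n + m - 1)\<^esub>a\<in>A. bul n m (f a) q)"
  by (rule additive_finsum[where h = "\<lambda>p. bul n m p q"])
    (use assms in \<open>auto intro: P.M.abelian_group_axioms bullet_closed bullet_add_l\<close>)

lemma bullet_finsum_r:
  assumes "p \<in> carrier (P n)" "f \<in> A \<rightarrow> carrier (P m)"
  shows "bul n m p (\<Oplus>\<^bsub>P m\<^esub>a\<in>A. f a) = (\<Oplus>\<^bsub>P (n + m - 1)\<^esub>a\<in>A. bul n m p (f a))"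
  by (rule additive_finsum)
    (use assms in \<open>auto intro: P.M.abelian_group_axioms bullet_closed bullet_add_r\<close>)

lemma partial_comp_finsum_l:
  assumes "i < n" "f \<in> A \<rightarrow> carrier (P n)" "q \<in> carrier (P m)"
  shows "pc n m i (\<Oplus>\<^bsub>P n\<^esub>a\<in>A. f a) q = (\<Oplus>\<^bsub>P (n + m - 1)\<^esub>a\<in>A. pc n m i (f a) q)"
  by (rule additive_finsum[where h = "\<lambda>p. pc n m i p q"])
    (use assms in \<open>auto intro: P.M.abelian_group_axioms partial_comp_closed partial_comp_add_l\<close>)

lemma partial_comp_finsum_r:
  assumes "i < n" "p \<in> carrier (P n)" "f \<in> A \<rightarrow> carrier (P m)"
  shows "pc n m i p (\<Oplus>\<^bsub>P m\<^esub>a\<in>A. f a) = (\<Oplus>\<^bsub>P (n + m - 1)\<^esub>a\<in>A. pc n m i p (f a))"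
  by (rule additive_finsum)
    (use assms in \<open>auto intro: P.M.abelian_group_axioms partial_comp_closed partial_comp_add_r\<close>)

text \<open>For fixed \<open>i\<close> the inputs of \<open>p \<circ>\<^sub>i q\<close> split into
  the \<open>m\<close> inputs of \<open>q\<close>, which give
  \<open>p \<circ>\<^sub>i (q \<bullet> r)\<close>, and the other inputs of \<open>p\<close>, which
  give simultaneous insertions.\<close>

lemma bullet_bullet:
  assumes n: "n > 0" and m: "m > 0"
    and p: "p \<in> carrier (P n)" and q: "q \<in> carrier (P m)" and r: "r \<in> carrier (P k)"
  shows "bul (n + m - 1) k (bul n m p q) r =
    bul n (m + k - 1) p (bul m k q r) \<oplus>\<^bsub>P (n + m + k - 2)\<^esub> double_insertion n m k p q r"
proof -
  let ?N = "n + m + k - 2"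
  have N: "n + m - 1 + k - 1 = ?N" "n + (m + k - 1) - 1 = ?N" using n m by auto
  let ?L = "\<lambda>i l. pc (n + m - 1) k l (pc n m i p q) r"
  have L_closed: "?L i l \<in> carrier (P ?N)" if "i < n" "l < n + m - 1" for i l
    using partial_comp_closed[OF that(2) partial_comp_closed[OF that(1) p q] r] N by simp
  have inner: "(\<Oplus>\<^bsub>P ?N\<^esub>l\<in>{..<n + m - 1}. ?L i l) =
      pc n (m + k - 1) i p (bul m k q r) \<oplus>\<^bsub>P ?N\<^esub>
      (\<Oplus>\<^bsub>P ?N\<^esub>j\<in>{..<n} - {i}. double_comp n i m j k p q r)"
    if i: "i < n" for i
  proof -
    \<comment> \<open>The number that input \<open>j \<noteq> i\<close> of \<open>p\<close> carries
      in \<open>p \<circ>\<^sub>i q\<close>; the inputs of \<open>q\<close> occupy \<open>i\<close>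
      to \<open>i + m - 1\<close>.\<close>
    let ?g = "\<lambda>j. if j < i then j else j + m - 1"
    have inj: "inj_on ?g ({..<n} - {i})"
      using m by (auto simp: inj_on_def split: if_splits)
    have union: "{..<n + m - 1} = (+) i ` {..<m} \<union> ?g ` ({..<n} - {i})"
    proof (intro equalityI subsetI)
      fix l assume l: "l \<in> {..<n + m - 1}"
      consider "l < i" | "i \<le> l" "l < i + m" | "i + m \<le> l" by linarith
      then show "l \<in> (+) i ` {..<m} \<union> ?g ` ({..<n} - {i})"
      proof cases
        case 1
        then have "l = ?g l" "l \<in> {..<n} - {i}" using i by auto
        then show ?thesis by blast
      next
        case 2
        then have "l = i + (l - i)" "l - i < m" by auto
        then show ?thesis by blast
      next
        case 3
        \<comment> \<open>Past the inputs of \<open>q\<close> the shift by \<open>m - 1\<close> is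
          undone.\<close>
        then have "l = ?g (l - m + 1)" "l - m + 1 \<in> {..<n} - {i}" using l m by auto
        then show ?thesis by blast
      qed
    qed (use i m in \<open>auto split: if_splits\<close>)
    have disj: "(+) i ` {..<m} \<inter> ?g ` ({..<n} - {i}) = {}"
      using m by (auto split: if_splits)
    have sub: "(+) i ` {..<m} \<subseteq> {..<n + m - 1}" "?g ` ({..<n} - {i}) \<subseteq> {..<n + m - 1}"
      using union by blast+
    have "(\<Oplus>\<^bsub>P ?N\<^esub>l\<in>{..<n + m - 1}. ?L i l) =
        (\<Oplus>\<^bsub>P ?N\<^esub>l\<in>(+) i ` {..<m}. ?L i l) \<oplus>\<^bsub>P ?N\<^esub>
        (\<Oplus>\<^bsub>P ?N\<^esub>l\<in>?g ` ({..<n} - {i}). ?L i l)"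
      unfolding union
      by (rule P.M.finsum_Un_disjoint) (use disj sub L_closed[OF i] in blast)+
    also have "(\<Oplus>\<^bsub>P ?N\<^esub>l\<in>(+) i ` {..<m}. ?L i l) = (\<Oplus>\<^bsub>P ?N\<^esub>t\<in>{..<m}. ?L i (i + t))"
      by (rule P.M.finsum_reindex) (use sub(1) L_closed[OF i] in \<open>auto simp: inj_on_def\<close>)
    also have "\<dots> = (\<Oplus>\<^bsub>P ?N\<^esub>t\<in>{..<m}. pc n (m + k - 1) i p (pc m k t q r))"
    proof (rule P.M.finsum_cong')
      show "(\<lambda>t. pc n (m + k - 1) i p (pc m k t q r)) \<in> {..<m} \<rightarrow> carrier (P ?N)"
        using partial_comp_closed[OF i p partial_comp_closed[OF _ q r]] N by auto
    qed (use i p q r in \<open>auto intro: comp_comp_inside\<close>)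
    also have "\<dots> = pc n (m + k - 1) i p (bul m k q r)"
      unfolding bullet_def
      by (subst partial_comp_finsum_r) (use i p q r N partial_comp_closed in auto)
    also have "(\<Oplus>\<^bsub>P ?N\<^esub>l\<in>?g ` ({..<n} - {i}). ?L i l) =
        (\<Oplus>\<^bsub>P ?N\<^esub>j\<in>{..<n} - {i}. ?L i (?g j))"
      by (rule P.M.finsum_reindex[OF _ inj]) (use sub(2) L_closed[OF i] in blast)
    also have "\<dots> = (\<Oplus>\<^bsub>P ?N\<^esub>j\<in>{..<n} - {i}. double_comp n i m j k p q r)"
      by (rule P.M.finsum_cong')
        (use i m p q r comp_comp_outside double_comp_closed in auto)
    finally show ?thesis .
  qed
  have pcb: "pc n (m + k - 1) i p (bul m k q r) \<in> carrier (P ?N)" if "i < n" for i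
    using partial_comp_closed[OF that p bullet_closed[OF q r]] N by simp
  have "bul (n + m - 1) k (bul n m p q) r =
      (\<Oplus>\<^bsub>P ?N\<^esub>l\<in>{..<n + m - 1}. pc (n + m - 1) k l (bul n m p q) r)"
    unfolding bullet_def[of _ _ _ "n + m - 1"] N ..
  \<comment> \<open>Linearity opens the inner product; the next step interchanges the sums, so that
    \<open>inner\<close> can be applied for each fixed \<open>i\<close>.\<close>
  also have "\<dots> = (\<Oplus>\<^bsub>P ?N\<^esub>l\<in>{..<n + m - 1}. \<Oplus>\<^bsub>P ?N\<^esub>i\<in>{..<n}. ?L i l)"
  proof (rule P.M.finsum_cong')
    fix l assume "l \<in> {..<n + m - 1}"
    then show "pc (n + m - 1) k l (bul n m p q) r = (\<Oplus>\<^bsub>P ?N\<^esub>i\<in>{..<n}. ?L i l)"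
      unfolding bullet_def using p q r
      by (subst partial_comp_finsum_l) (auto simp: N partial_comp_closed)
  qed (use L_closed in \<open>auto intro!: P.M.finsum_closed\<close>)
  also have "\<dots> = (\<Oplus>\<^bsub>P ?N\<^esub>i\<in>{..<n}. \<Oplus>\<^bsub>P ?N\<^esub>l\<in>{..<n + m - 1}. ?L i l)"
  proof (rule P.M.finsum_nested_reindex)
    show "bij_betw prod.swap ({..<n} \<times> {..<n + m - 1}) ({..<n + m - 1} \<times> {..<n})"
      by (rule bij_betwI[where g = prod.swap]) auto
  qed (use L_closed in auto)
  also have "\<dots> = (\<Oplus>\<^bsub>P ?N\<^esub>i\<in>{..<n}. pc n (m + k - 1) i p (bul m k q r) \<oplus>\<^bsub>P ?N\<^esub>
      (\<Oplus>\<^bsub>P ?N\<^esub>j\<in>{..<n} - {i}. double_comp n i m j k p q r))"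
    by (rule P.M.finsum_cong')
      (use inner pcb p q r double_comp_closed in \<open>auto intro!: P.M.finsum_closed P.M.a_closed\<close>)
  also have "\<dots> = bul n (m + k - 1) p (bul m k q r) \<oplus>\<^bsub>P ?N\<^esub> double_insertion n m k p q r"
    unfolding bullet_def[of _ _ _ n "m + k - 1"] N double_insertion_def
    by (rule P.M.finsum_addf)
      (use pcb p q r double_comp_closed in \<open>auto intro!: P.M.finsum_closed\<close>)
  finally show ?thesis .
qed

end

end

context operad
begin

subsection \<open>The coinvariant relations form an ideal\<close>

abbreviation D where "D \<equiv> direct_sum {1..} P"

sublocale D: module K D
  by (rule direct_sum_module[OF is_cring module_P])

abbreviation ker where "ker \<equiv> coinv_kernel K P act"

lemma coinv_kernel_gens:
  "{p \<ominus>\<^bsub>P n\<^esub> act n p \<sigma> | p \<sigma>. p \<in> carrier (P n) \<and> \<sigma> permutes {..<n}} \<subseteq> carrier (P n)"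
  using act_closed by auto

lemma coinv_kernel_submodule: "submodule (ker n) K (P n)"
  unfolding coinv_kernel_def by (rule vect_submodule[OF module_P coinv_kernel_gens])

lemma coinv_kernel_act:
  "p \<in> carrier (P n) \<Longrightarrow> \<sigma> permutes {..<n} \<Longrightarrow> p \<ominus>\<^bsub>P n\<^esub> act n p \<sigma> \<in> ker n"
  using vect_incl[OF module_P coinv_kernel_gens] unfolding coinv_kernel_def by blast

lemma coinv_kernel_least:
  assumes "submodule H K (P n)"
    and "\<And>p \<sigma>. p \<in> carrier (P n) \<Longrightarrow> \<sigma> permutes {..<n} \<Longrightarrow> p \<ominus>\<^bsub>P n\<^esub> act n p \<sigma> \<in> H"
  shows "ker n \<subseteq> H"
  unfolding coinv_kernel_def by (rule vect_least) (use assms in auto)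

text \<open>Combined with \<open>coinv_kernel_least\<close>: the elements whose product with a fixed
  factor lies in the kernel form a submodule, so the ideal property has to be tested on the
  relations \<open>p - act n p \<sigma>\<close> only.\<close>

lemma submodule_vimage:
  assumes H: "submodule H K (P m)"
    and h: "\<And>p. p \<in> carrier (P n) \<Longrightarrow> h p \<in> carrier (P m)"
      "\<And>p p'. p \<in> carrier (P n) \<Longrightarrow> p' \<in> carrier (P n) \<Longrightarrow> h (p \<oplus>\<^bsub>P n\<^esub> p') = h p \<oplus>\<^bsub>P m\<^esub> h p'"
      "\<And>a p. a \<in> carrier K \<Longrightarrow> p \<in> carrier (P n) \<Longrightarrow> h (a \<odot>\<^bsub>P n\<^esub> p) = a \<odot>\<^bsub>P m\<^esub> h p"
  shows "submodule {p \<in> carrier (P n). h p \<in> H} K (P n)"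
proof (rule P.submoduleI)
  have 0: "h \<zero>\<^bsub>P n\<^esub> = \<zero>\<^bsub>P m\<^esub>"
    by (rule additive_zero) (use h in \<open>auto intro: P.M.abelian_group_axioms\<close>)
  have zero: "\<zero>\<^bsub>P m\<^esub> \<in> H" using subgroup.one_closed[OF submodule.axioms(1)[OF H]] by simp
  show "\<zero>\<^bsub>P n\<^esub> \<in> {p \<in> carrier (P n). h p \<in> H}" using 0 zero by simp
  show "\<ominus>\<^bsub>P n\<^esub> p \<in> {p \<in> carrier (P n). h p \<in> H}" if "p \<in> {p \<in> carrier (P n). h p \<in> H}" for p
  proof -
    have p: "p \<in> carrier (P n)" "h p \<in> H" using that by auto
    have "h (\<zero>\<^bsub>P n\<^esub> \<ominus>\<^bsub>P n\<^esub> p) = h \<zero>\<^bsub>P n\<^esub> \<ominus>\<^bsub>P m\<^esub> h p"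
      by (rule additive_minus) (use h p in \<open>auto intro: P.M.abelian_group_axioms\<close>)
    then have "h (\<ominus>\<^bsub>P n\<^esub> p) = \<ominus>\<^bsub>P m\<^esub> h p"
      using p h(1)[OF p(1)] by (simp add: 0 a_minus_def)
    then show ?thesis using P.submoduleE(3)[OF H p(2)] p by simp
  qed
qed (use h P.submoduleE(4,5)[OF H] in auto)

section \<open>Partial compositions and the symmetric group actions\<close>

lemma partial_comp_act_r:
  assumes i: "i < n" and p: "p \<in> carrier (P n)" and q: "q \<in> carrier (P m)" and \<tau>: "\<tau> permutes {..<m}"
  shows "\<exists>\<rho>. \<rho> permutes {..<n + m - 1} \<and> pc n m i p (act m q \<tau>) = act (n + m - 1) (pc n m i p q) \<rho>"
proof -
  let ?ks = "(replicate n 1)[i := m]" and ?qs = "(replicate n I)[i := q]"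
    and ?\<tau>s = "(replicate n id)[i := \<tau>]"
  have perms: "list_all2 (\<lambda>k \<tau>. \<tau> permutes {..<k}) ?ks ?\<tau>s"
    using \<tau> i by (auto simp: list_all2_conv_all_nth nth_list_update permutes_id)
  have tup: "tuple_in P ?ks ?qs" by (intro tuple_in_intros q)
  \<comment> \<open>The identity acts on the units, so inner equivariance changes the entry at
    \<open>i\<close> only.\<close>
  have "map (\<lambda>j. act (?ks ! j) (?qs ! j) (?\<tau>s ! j)) [0..<length ?ks] = (replicate n I)[i := act m q \<tau>]"
    using act_id[OF unit_closed] i by (intro nth_equalityI) (auto simp: nth_list_update)
  then have "pc n m i p (act m q \<tau>) = act (n + m - 1) (pc n m i p q) (block_sum ?ks ?\<tau>s)"
    using equivariance_inner[OF _ tup perms, of p] p sum_list_ones_update[OF i, of m]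
    by (simp add: partial_comp_def)
  moreover have "block_sum ?ks ?\<tau>s permutes {..<n + m - 1}"
    using block_sum_permutes[OF perms] sum_list_ones_update[OF i, of m] by simp
  ultimately show ?thesis by blast
qed

text \<open>Outer equivariance rearranges the inserted operations, which carries \<open>q\<close>
  from input \<open>i\<close> to input \<open>\<sigma> i\<close>. Passing to coinvariants requires
  only that some permutation \<open>\<rho>\<close> of the inputs exists.\<close>

lemma partial_comp_act_l:
  assumes i: "i < n" and p: "p \<in> carrier (P n)" and q: "q \<in> carrier (P m)" and \<sigma>: "\<sigma> permutes {..<n}"
  shows "\<exists>\<rho>. \<rho> permutes {..<n + m - 1} \<and>
    pc n m i (act n p \<sigma>) q = act (n + m - 1) (pc n m (\<sigma> i) p q) \<rho>"
proof -
  let ?ks = "(replicate n 1)[i := m]" and ?qs = "(replicate n I)[i := q]"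
  have tup: "tuple_in P ?ks ?qs" by (intro tuple_in_intros q)
  have len: "length ?ks = n" by simp
  have \<sigma>i: "\<sigma> i < n" using permutes_in_image[OF \<sigma>, of i] i by simp
  \<comment> \<open>Stated for any type of entries, as both the arities and the operations are
    rearranged.\<close>
  have perm: "permute_list (inv_into UNIV \<sigma>) ((replicate n a)[i := b]) = (replicate n a)[\<sigma> i := b]"
    for a b :: 'x
  proof (rule nth_equalityI)
    fix j assume "j < length (permute_list (inv_into UNIV \<sigma>) ((replicate n a)[i := b]))"
    then have j: "j < n" by simp
    have inv: "inv_into UNIV \<sigma> permutes {..<n}" by (rule permutes_inv[OF \<sigma>])
    have "inv_into UNIV \<sigma> j < n" using permutes_in_image[OF inv, of j] j by simp
    moreover have "inv_into UNIV \<sigma> j = i \<longleftrightarrow> j = \<sigma> i"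
      using permutes_inverses[OF \<sigma>] by metis
    ultimately show "permute_list (inv_into UNIV \<sigma>) ((replicate n a)[i := b]) ! j =
        (replicate n a)[\<sigma> i := b] ! j"
      using j inv by (auto simp: permute_list_nth nth_list_update)
  qed simp
  have "pc n m i (act n p \<sigma>) q = act (n + m - 1) (pc n m (\<sigma> i) p q) (block_perm ?ks \<sigma>)"
    using equivariance_outer[OF _ tup, of p \<sigma>] p \<sigma> sum_list_ones_update[OF i, of m]
    by (simp add: partial_comp_def perm)
  moreover have "block_perm ?ks \<sigma> permutes {..<n + m - 1}"
    using block_perm_permutes[of \<sigma> ?ks] \<sigma> sum_list_ones_update[OF i, of m] by simp
  ultimately show ?thesis by blast
qed

context
  notes One_nat_def [simp del]
begin

lemma coinv_kernel_bullet_r: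
  assumes p: "p \<in> carrier (P n)" and q: "q \<in> ker m"
  shows "bul n m p q \<in> ker (n + m - 1)"
proof -
  have "ker m \<subseteq> {q \<in> carrier (P m). bul n m p q \<in> ker (n + m - 1)}"
  proof (rule coinv_kernel_least)
    show "submodule {q \<in> carrier (P m). bul n m p q \<in> ker (n + m - 1)} K (P m)"
      by (rule submodule_vimage[OF coinv_kernel_submodule])
        (use p in \<open>auto intro: bullet_closed bullet_add_r bullet_smult_r\<close>)
    fix q \<tau> assume q: "q \<in> carrier (P m)" and \<tau>: "\<tau> permutes {..<m}"
    have "pc n m i p (q \<ominus>\<^bsub>P m\<^esub> act m q \<tau>) \<in> ker (n + m - 1)" if i: "i < n" for i
    proof -
      obtain \<rho> where \<rho>: "\<rho> permutes {..<n + m - 1}"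
        "pc n m i p (act m q \<tau>) = act (n + m - 1) (pc n m i p q) \<rho>"
        using partial_comp_act_r[OF i p q \<tau>] by blast
      have "pc n m i p (q \<ominus>\<^bsub>P m\<^esub> act m q \<tau>) = pc n m i p q \<ominus>\<^bsub>P (n + m - 1)\<^esub> pc n m i p (act m q \<tau>)"
        by (rule additive_minus) (use i p q \<tau> in \<open>auto intro: P.M.abelian_group_axioms
            partial_comp_closed partial_comp_add_r act_closed\<close>)
      then show ?thesis
        using coinv_kernel_act[OF partial_comp_closed[OF i p q] \<rho>(1)] by (simp add: \<rho>(2))
    qed
    then have "bul n m p (q \<ominus>\<^bsub>P m\<^esub> act m q \<tau>) \<in> ker (n + m - 1)"
      unfolding bullet_def by (intro P.submodule_finsum[OF coinv_kernel_submodule]) simp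
    then show "q \<ominus>\<^bsub>P m\<^esub> act m q \<tau> \<in> {q \<in> carrier (P m). bul n m p q \<in> ker (n + m - 1)}"
      using q \<tau> act_closed by simp
  qed
  then show ?thesis using q by blast
qed

text \<open>The relation matches position \<open>\<sigma> i\<close> for \<open>p\<close> with
  position \<open>i\<close> for \<open>act n p \<sigma>\<close>, so the sum for \<open>p\<close> is
  reindexed by \<open>\<sigma>\<close> before the two sums are subtracted term by term.\<close>

lemma coinv_kernel_bullet_l:
  assumes p: "p \<in> ker n" and q: "q \<in> carrier (P m)"
  shows "bul n m p q \<in> ker (n + m - 1)"
proof -
  let ?N = "n + m - 1"
  have "ker n \<subseteq> {p \<in> carrier (P n). bul n m p q \<in> ker ?N}"
  proof (rule coinv_kernel_least)
    show "submodule {p \<in> carrier (P n). bul n m p q \<in> ker ?N} K (P n)"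
      by (rule submodule_vimage[OF coinv_kernel_submodule])
        (use q in \<open>auto intro: bullet_closed bullet_add_l bullet_smult_l\<close>)
    fix p \<sigma> assume p: "p \<in> carrier (P n)" and \<sigma>: "\<sigma> permutes {..<n}"
    have \<sigma>_less: "\<sigma> i < n" if "i < n" for i
      using permutes_in_image[OF \<sigma>, of i] that by simp
    have *: "pc n m (\<sigma> i) p q \<ominus>\<^bsub>P ?N\<^esub> pc n m i (act n p \<sigma>) q \<in> ker ?N" if i: "i < n" for i
    proof -
      obtain \<rho> where \<rho>: "\<rho> permutes {..<?N}"
        "pc n m i (act n p \<sigma>) q = act ?N (pc n m (\<sigma> i) p q) \<rho>"
        using partial_comp_act_l[OF i p q \<sigma>] by blast
      then show ?thesis
        using coinv_kernel_act[OF partial_comp_closed[OF \<sigma>_less[OF i] p q] \<rho>(1)] by simp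
    qed
    have "bul n m p q = (\<Oplus>\<^bsub>P ?N\<^esub>i\<in>\<sigma> ` {..<n}. pc n m i p q)"
      unfolding bullet_def permutes_image[OF \<sigma>] ..
    also have "\<dots> = (\<Oplus>\<^bsub>P ?N\<^esub>i\<in>{..<n}. pc n m (\<sigma> i) p q)"
      by (rule P.M.finsum_reindex)
        (use \<sigma>_less p q partial_comp_closed permutes_inj_on[OF \<sigma>] in auto)
    finally have reindexed: "bul n m p q = (\<Oplus>\<^bsub>P ?N\<^esub>i\<in>{..<n}. pc n m (\<sigma> i) p q)" .
    have "bul n m (p \<ominus>\<^bsub>P n\<^esub> act n p \<sigma>) q = bul n m p q \<ominus>\<^bsub>P ?N\<^esub> bul n m (act n p \<sigma>) q"
      by (rule additive_minus[where h = "\<lambda>p. bul n m p q"])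
        (use p q \<sigma> in \<open>auto intro: P.M.abelian_group_axioms bullet_closed bullet_add_l act_closed\<close>)
    also have "\<dots> = (\<Oplus>\<^bsub>P ?N\<^esub>i\<in>{..<n}. pc n m (\<sigma> i) p q \<ominus>\<^bsub>P ?N\<^esub> pc n m i (act n p \<sigma>) q)"
      unfolding reindexed unfolding bullet_def
      by (rule P.M.finsum_minus) (use \<sigma>_less p q \<sigma> partial_comp_closed act_closed in auto)
    also have "\<dots> \<in> ker ?N"
      by (rule P.submodule_finsum[OF coinv_kernel_submodule]) (use * in simp)
    finally show "p \<ominus>\<^bsub>P n\<^esub> act n p \<sigma> \<in> {p \<in> carrier (P n). bul n m p q \<in> ker ?N}"
      using p \<sigma> act_closed by simp
  qed
  then show ?thesis using p by blast
qed

subsection \<open>The product on the direct sum\<close>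

abbreviation A where "A \<equiv> operad_algebra P \<gamma> I"

lemma operad_algebra_sel:
  "carrier A = carrier D" "add A = add D" "zero A = zero D" "smult A = smult D"
  "x \<ominus>\<^bsub>A\<^esub> y = x \<ominus>\<^bsub>D\<^esub> y"
  by (simp_all add: operad_algebra_def a_minus_mult_update)

lemma operad_algebra_mult:
  "r \<ge> 1 \<Longrightarrow> (x \<otimes>\<^bsub>A\<^esub> y) r = (\<Oplus>\<^bsub>P r\<^esub>n\<in>{1..r}. bul n (r + 1 - n) (x n) (y (r + 1 - n)))"
  by (simp add: operad_algebra_def)

lemma D_closed: "x \<in> carrier D \<Longrightarrow> n \<ge> 1 \<Longrightarrow> x n \<in> carrier (P n)"
  by (rule direct_sum_component_closed) auto

lemma bullet_closed_arity:
  assumes "n \<in> {1..r}" "p \<in> carrier (P n)" "q \<in> carrier (P (r + 1 - n))"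
  shows "bul n (r + 1 - n) p q \<in> carrier (P r)"
  using bullet_closed[OF assms(2,3)] assms(1) by simp

lemma bullet_term_closed:
  "x \<in> carrier D \<Longrightarrow> y \<in> carrier D \<Longrightarrow> n \<in> {1..r} \<Longrightarrow>
    bul n (r + 1 - n) (x n) (y (r + 1 - n)) \<in> carrier (P r)"
  by (intro bullet_closed_arity D_closed) auto

lemma operad_algebra_mult_component_closed:
  "x \<in> carrier D \<Longrightarrow> y \<in> carrier D \<Longrightarrow> r \<ge> 1 \<Longrightarrow> (x \<otimes>\<^bsub>A\<^esub> y) r \<in> carrier (P r)"
  unfolding operad_algebra_mult by (intro P.M.finsum_closed Pi_I bullet_term_closed)

lemma bullet_zero_l: "q \<in> carrier (P m) \<Longrightarrow> bul n m \<zero>\<^bsub>P n\<^esub> q = \<zero>\<^bsub>P (n + m - 1)\<^esub>"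
  by (rule additive_zero[where h = "\<lambda>p. bul n m p q"])
    (auto intro: P.M.abelian_group_axioms bullet_closed bullet_add_l)

lemma bullet_zero_r: "p \<in> carrier (P n) \<Longrightarrow> bul n m p \<zero>\<^bsub>P m\<^esub> = \<zero>\<^bsub>P (n + m - 1)\<^esub>"
  by (rule additive_zero)
    (auto intro: P.M.abelian_group_axioms bullet_closed bullet_add_r)

text \<open>Used twice: it bounds the support of a product, and it places the product of homogeneous
  elements in the right degree.\<close>

lemma operad_algebra_mult_eq_zero:
  assumes x: "x \<in> carrier D" and y: "y \<in> carrier D" and r: "r \<ge> 1"
    and *: "\<And>n. n \<in> {1..r} \<Longrightarrow> x n = \<zero>\<^bsub>P n\<^esub> \<or> y (r + 1 - n) = \<zero>\<^bsub>P (r + 1 - n)\<^esub>"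
  shows "(x \<otimes>\<^bsub>A\<^esub> y) r = \<zero>\<^bsub>P r\<^esub>"
  unfolding operad_algebra_mult[OF r]
proof (rule P.M.add.finprod_one_eqI)
  fix n assume n: "n \<in> {1..r}"
  have "x n \<in> carrier (P n)" "y (r + 1 - n) \<in> carrier (P (r + 1 - n))" "n + (r + 1 - n) - 1 = r"
    using D_closed[OF x, of n] D_closed[OF y, of "r + 1 - n"] n by auto
  then show "bul n (r + 1 - n) (x n) (y (r + 1 - n)) = \<zero>\<^bsub>P r\<^esub>"
    using *[OF n] bullet_zero_l[of "y (r + 1 - n)" "r + 1 - n" n]
      bullet_zero_r[of "x n" n "r + 1 - n"] by auto
qed

lemma operad_algebra_mult_closed:
  assumes x: "x \<in> carrier D" and y: "y \<in> carrier D"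
  shows "x \<otimes>\<^bsub>A\<^esub> y \<in> carrier D"
proof (rule direct_sum_carrierI)
  let ?S = "\<lambda>x. {n \<in> {1..}. x n \<noteq> \<zero>\<^bsub>P n\<^esub>}"
  \<comment> \<open>The arities that can arise from nonzero components of \<open>x\<close> and
    \<open>y\<close>; a finite set containing the support of the product.\<close>
  let ?T = "(\<lambda>(n, m). n + m - 1) ` (?S x \<times> ?S y)"
  show "finite ?T"
    using direct_sum_finite_support[OF x] direct_sum_finite_support[OF y] by blast
  fix r :: nat assume "r \<in> {1..}"
  then have r: "r \<ge> 1" by simp
  then show "(x \<otimes>\<^bsub>A\<^esub> y) r \<in> carrier (P r)" using operad_algebra_mult_component_closed x y by simp
  assume "r \<notin> ?T"
  have "x n = \<zero>\<^bsub>P n\<^esub> \<or> y (r + 1 - n) = \<zero>\<^bsub>P (r + 1 - n)\<^esub>" if n: "n \<in> {1..r}" for n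
  proof (rule ccontr)
    assume "\<not> ?thesis"
    then have "(n, r + 1 - n) \<in> ?S x \<times> ?S y" using n by auto
    then have "(case (n, r + 1 - n) of (n, m) \<Rightarrow> n + m - 1) \<in> ?T" by (rule imageI)
    then show False using \<open>r \<notin> ?T\<close> n by simp
  qed
  then show "(x \<otimes>\<^bsub>A\<^esub> y) r = \<zero>\<^bsub>P r\<^esub>" by (rule operad_algebra_mult_eq_zero[OF x y r])
qed (simp add: operad_algebra_def)

lemma operad_algebra_mult_degree:
  assumes "x \<in> degree_part P d" "y \<in> degree_part P e"
  shows "x \<otimes>\<^bsub>A\<^esub> y \<in> degree_part P (d + e)"
proof -
  have x: "x \<in> carrier D" "\<And>n. n \<ge> 1 \<Longrightarrow> n \<noteq> d + 1 \<Longrightarrow> x n = \<zero>\<^bsub>P n\<^esub>"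
    and y: "y \<in> carrier D" "\<And>n. n \<ge> 1 \<Longrightarrow> n \<noteq> e + 1 \<Longrightarrow> y n = \<zero>\<^bsub>P n\<^esub>"
    using assms by (auto simp: degree_part_def direct_sum_component_def)
  have "(x \<otimes>\<^bsub>A\<^esub> y) r = \<zero>\<^bsub>P r\<^esub>" if r: "r \<ge> 1" "r \<noteq> d + e + 1" for r
  proof (rule operad_algebra_mult_eq_zero[OF x(1) y(1) r(1)])
    fix n assume "n \<in> {1..r}"
    \<comment> \<open>If \<open>n = d + 1\<close>, the partner has arity \<open>r - d\<close>, which
      is \<open>e + 1\<close> only for \<open>r = d + e + 1\<close>.\<close>
    with r show "x n = \<zero>\<^bsub>P n\<^esub> \<or> y (r + 1 - n) = \<zero>\<^bsub>P (r + 1 - n)\<^esub>"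
      using x(2)[of n] y(2)[of "r + 1 - n"] by (cases "n = d + 1") auto
  qed
  then show ?thesis
    using operad_algebra_mult_closed[OF x(1) y(1)]
    by (auto simp: degree_part_def direct_sum_component_def)
qed

lemma operad_algebra_l_distr:
  assumes x: "x \<in> carrier D" and y: "y \<in> carrier D" and z: "z \<in> carrier D"
  shows "(x \<oplus>\<^bsub>D\<^esub> y) \<otimes>\<^bsub>A\<^esub> z = (x \<otimes>\<^bsub>A\<^esub> z) \<oplus>\<^bsub>D\<^esub> (y \<otimes>\<^bsub>A\<^esub> z)"
proof (rule direct_sum_eqI)
  fix r :: nat assume r: "r \<in> {1..}"
  have "bul n (r + 1 - n) ((x \<oplus>\<^bsub>D\<^esub> y) n) (z (r + 1 - n)) =
      bul n (r + 1 - n) (x n) (z (r + 1 - n)) \<oplus>\<^bsub>P r\<^esub> bul n (r + 1 - n) (y n) (z (r + 1 - n))"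
    if n: "n \<in> {1..r}" for n
  proof -
    have "1 \<le> r + 1 - n" using n by auto
    then show ?thesis
      using bullet_add_l[of "x n" n "y n" "z (r + 1 - n)" "r + 1 - n"] n
        D_closed[OF x, of n] D_closed[OF y, of n] D_closed[OF z, of "r + 1 - n"] by simp
  qed
  then have "((x \<oplus>\<^bsub>D\<^esub> y) \<otimes>\<^bsub>A\<^esub> z) r = (\<Oplus>\<^bsub>P r\<^esub>n\<in>{1..r}.
      bul n (r + 1 - n) (x n) (z (r + 1 - n)) \<oplus>\<^bsub>P r\<^esub> bul n (r + 1 - n) (y n) (z (r + 1 - n)))"
    using r x y z by (simp only: operad_algebra_mult atLeast_iff)
      (rule P.M.finsum_cong', auto intro!: P.M.a_closed bullet_term_closed)
  also have "\<dots> = (x \<otimes>\<^bsub>A\<^esub> z) r \<oplus>\<^bsub>P r\<^esub> (y \<otimes>\<^bsub>A\<^esub> z) r"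
    using r x y z by (simp only: operad_algebra_mult atLeast_iff)
      (rule P.M.finsum_addf, auto intro!: bullet_term_closed)
  finally show "((x \<oplus>\<^bsub>D\<^esub> y) \<otimes>\<^bsub>A\<^esub> z) r = ((x \<otimes>\<^bsub>A\<^esub> z) \<oplus>\<^bsub>D\<^esub> (y \<otimes>\<^bsub>A\<^esub> z)) r"
    using r by simp
qed (use x y z operad_algebra_mult_closed in auto)

lemma operad_algebra_r_distr:
  assumes x: "x \<in> carrier D" and y: "y \<in> carrier D" and z: "z \<in> carrier D"
  shows "x \<otimes>\<^bsub>A\<^esub> (y \<oplus>\<^bsub>D\<^esub> z) = (x \<otimes>\<^bsub>A\<^esub> y) \<oplus>\<^bsub>D\<^esub> (x \<otimes>\<^bsub>A\<^esub> z)"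
proof (rule direct_sum_eqI)
  fix r :: nat assume r: "r \<in> {1..}"
  have "bul n (r + 1 - n) (x n) ((y \<oplus>\<^bsub>D\<^esub> z) (r + 1 - n)) =
      bul n (r + 1 - n) (x n) (y (r + 1 - n)) \<oplus>\<^bsub>P r\<^esub> bul n (r + 1 - n) (x n) (z (r + 1 - n))"
    if n: "n \<in> {1..r}" for n
  proof -
    have "r + 1 - n \<in> {1..}" using n by auto
    then show ?thesis
      using bullet_add_r[of "x n" n "y (r + 1 - n)" "r + 1 - n" "z (r + 1 - n)"] n
        D_closed[OF x, of n] D_closed[OF y, of "r + 1 - n"] D_closed[OF z, of "r + 1 - n"] by simp
  qed
  then have "(x \<otimes>\<^bsub>A\<^esub> (y \<oplus>\<^bsub>D\<^esub> z)) r = (\<Oplus>\<^bsub>P r\<^esub>n\<in>{1..r}.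
      bul n (r + 1 - n) (x n) (y (r + 1 - n)) \<oplus>\<^bsub>P r\<^esub> bul n (r + 1 - n) (x n) (z (r + 1 - n)))"
    using r x y z by (simp only: operad_algebra_mult atLeast_iff)
      (rule P.M.finsum_cong', auto intro!: P.M.a_closed bullet_term_closed)
  also have "\<dots> = (x \<otimes>\<^bsub>A\<^esub> y) r \<oplus>\<^bsub>P r\<^esub> (x \<otimes>\<^bsub>A\<^esub> z) r"
    using r x y z by (simp only: operad_algebra_mult atLeast_iff)
      (rule P.M.finsum_addf, auto intro!: bullet_term_closed)
  finally show "(x \<otimes>\<^bsub>A\<^esub> (y \<oplus>\<^bsub>D\<^esub> z)) r = ((x \<otimes>\<^bsub>A\<^esub> y) \<oplus>\<^bsub>D\<^esub> (x \<otimes>\<^bsub>A\<^esub> z)) r"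
    using r by simp
qed (use x y z operad_algebra_mult_closed in auto)

lemma operad_algebra_smult_l:
  assumes a: "a \<in> carrier K" and x: "x \<in> carrier D" and y: "y \<in> carrier D"
  shows "(a \<odot>\<^bsub>D\<^esub> x) \<otimes>\<^bsub>A\<^esub> y = a \<odot>\<^bsub>D\<^esub> (x \<otimes>\<^bsub>A\<^esub> y)"
proof (rule direct_sum_eqI)
  fix r :: nat assume r: "r \<in> {1..}"
  have "bul n (r + 1 - n) ((a \<odot>\<^bsub>D\<^esub> x) n) (y (r + 1 - n)) =
      a \<odot>\<^bsub>P r\<^esub> bul n (r + 1 - n) (x n) (y (r + 1 - n))"
    if n: "n \<in> {1..r}" for n
  proof -
    have "1 \<le> r + 1 - n" using n by auto
    then show ?thesis
      using bullet_smult_l[of a "x n" n "y (r + 1 - n)" "r + 1 - n"] n a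
        D_closed[OF x, of n] D_closed[OF y, of "r + 1 - n"] by simp
  qed
  then have "((a \<odot>\<^bsub>D\<^esub> x) \<otimes>\<^bsub>A\<^esub> y) r = (\<Oplus>\<^bsub>P r\<^esub>n\<in>{1..r}.
      a \<odot>\<^bsub>P r\<^esub> bul n (r + 1 - n) (x n) (y (r + 1 - n)))"
    using r a x y by (simp only: operad_algebra_mult atLeast_iff)
      (rule P.M.finsum_cong', auto intro!: P.smult_closed bullet_term_closed)
  also have "\<dots> = a \<odot>\<^bsub>P r\<^esub> (x \<otimes>\<^bsub>A\<^esub> y) r"
    using r a x y by (simp only: operad_algebra_mult atLeast_iff)
      (rule P.finsum_smult_ldistr[symmetric], auto intro!: bullet_term_closed)
  finally show "((a \<odot>\<^bsub>D\<^esub> x) \<otimes>\<^bsub>A\<^esub> y) r = (a \<odot>\<^bsub>D\<^esub> (x \<otimes>\<^bsub>A\<^esub> y)) r"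
    using r by simp
qed (use a x y operad_algebra_mult_closed in auto)

lemma operad_algebra_smult_r:
  assumes a: "a \<in> carrier K" and x: "x \<in> carrier D" and y: "y \<in> carrier D"
  shows "x \<otimes>\<^bsub>A\<^esub> (a \<odot>\<^bsub>D\<^esub> y) = a \<odot>\<^bsub>D\<^esub> (x \<otimes>\<^bsub>A\<^esub> y)"
proof (rule direct_sum_eqI)
  fix r :: nat assume r: "r \<in> {1..}"
  have "bul n (r + 1 - n) (x n) ((a \<odot>\<^bsub>D\<^esub> y) (r + 1 - n)) =
      a \<odot>\<^bsub>P r\<^esub> bul n (r + 1 - n) (x n) (y (r + 1 - n))"
    if n: "n \<in> {1..r}" for n
  proof -
    have "r + 1 - n \<in> {1..}" using n by auto
    then show ?thesis
      using bullet_smult_r[of a "x n" n "y (r + 1 - n)" "r + 1 - n"] n a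
        D_closed[OF x, of n] D_closed[OF y, of "r + 1 - n"] by simp
  qed
  then have "(x \<otimes>\<^bsub>A\<^esub> (a \<odot>\<^bsub>D\<^esub> y)) r = (\<Oplus>\<^bsub>P r\<^esub>n\<in>{1..r}.
      a \<odot>\<^bsub>P r\<^esub> bul n (r + 1 - n) (x n) (y (r + 1 - n)))"
    using r a x y by (simp only: operad_algebra_mult atLeast_iff)
      (rule P.M.finsum_cong', auto intro!: P.smult_closed bullet_term_closed)
  also have "\<dots> = a \<odot>\<^bsub>P r\<^esub> (x \<otimes>\<^bsub>A\<^esub> y) r"
    using r a x y by (simp only: operad_algebra_mult atLeast_iff)
      (rule P.finsum_smult_ldistr[symmetric], auto intro!: bullet_term_closed)
  finally show "(x \<otimes>\<^bsub>A\<^esub> (a \<odot>\<^bsub>D\<^esub> y)) r = (a \<odot>\<^bsub>D\<^esub> (x \<otimes>\<^bsub>A\<^esub> y)) r"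
    using r by simp
qed (use a x y operad_algebra_mult_closed in auto)

section \<open>The associator on the direct sum\<close>

definition triple_insertion :: "(nat \<Rightarrow> 'a) \<Rightarrow> (nat \<Rightarrow> 'a) \<Rightarrow> (nat \<Rightarrow> 'a) \<Rightarrow> nat \<Rightarrow> 'a" where
  "triple_insertion x y z r = (\<Oplus>\<^bsub>P r\<^esub>n\<in>{1..r}. \<Oplus>\<^bsub>P r\<^esub>m\<in>{1..r + 1 - n}.
    double_insertion n m (r + 2 - n - m) (x n) (y m) (z (r + 2 - n - m)))"

context
  fixes x y z :: "nat \<Rightarrow> 'a" and r :: nat
  assumes x: "x \<in> carrier D" and y: "y \<in> carrier D" and z: "z \<in> carrier D" and r: "r \<ge> 1"
begin

lemma double_insertion_term_closed:
  assumes "n \<in> {1..r}" "m \<in> {1..r + 1 - n}"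
  shows "double_insertion n m (r + 2 - n - m) (x n) (y m) (z (r + 2 - n - m)) \<in> carrier (P r)"
proof -
  have "n + m + (r + 2 - n - m) - 2 = r" "1 \<le> r + 2 - n - m" using assms by auto
  then show ?thesis
    using double_insertion_closed[OF D_closed[OF x] D_closed[OF y] D_closed[OF z],
      of n m "r + 2 - n - m"] assms by simp
qed

lemma triple_insertion_closed: "triple_insertion x y z r \<in> carrier (P r)"
  unfolding triple_insertion_def
  by (intro P.M.finsum_closed Pi_I double_insertion_term_closed)

text \<open>The three arities satisfy \<open>n + m + k = r + 2\<close>. Keeping \<open>n\<close> and
  exchanging \<open>m\<close> with \<open>k\<close> is an involution of the index set, and
  \<open>double_insertion_swap\<close> compares the terms.\<close>

lemma triple_insertion_swap: "triple_insertion x y z r = triple_insertion x z y r"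
  unfolding triple_insertion_def
proof (rule P.M.finsum_nested_reindex)
  let ?h = "\<lambda>(n, m). (n, r + 2 - n - m)"
  show "bij_betw ?h (SIGMA n:{1..r}. {1..r + 1 - n}) (SIGMA n:{1..r}. {1..r + 1 - n})"
    by (rule bij_betwI[where g = ?h]) auto
  fix n m assume n: "n \<in> {1..r}" and m: "m \<in> {1..r + 1 - n}"
  have *: "r + 2 - n - (r + 2 - n - m) = m" "1 \<le> r + 2 - n - m" using n m by auto
  show "double_insertion n m (r + 2 - n - m) (x n) (z m) (y (r + 2 - n - m)) =
    (case ?h (n, m) of (n, m) \<Rightarrow>
      double_insertion n m (r + 2 - n - m) (x n) (y m) (z (r + 2 - n - m)))"
    using double_insertion_swap[OF D_closed[OF x] D_closed[OF z] D_closed[OF y],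
      of n m "r + 2 - n - m"] n m * by simp
qed ((rule double_insertion_term_closed; assumption) | simp)+

text \<open>Once the double sum is indexed by the arities of the parts of \<open>x\<close> and
  \<open>y\<close>, \<open>bullet_bullet\<close> applies to every term, and its two summands collect
  to the two terms on the right.\<close>

lemma operad_algebra_mult_mult:
  "((x \<otimes>\<^bsub>A\<^esub> y) \<otimes>\<^bsub>A\<^esub> z) r = (x \<otimes>\<^bsub>A\<^esub> (y \<otimes>\<^bsub>A\<^esub> z)) r \<oplus>\<^bsub>P r\<^esub> triple_insertion x y z r"
proof -
  let ?k = "\<lambda>n m. r + 2 - n - m"
  let ?L = "\<lambda>s n. bul s (r + 1 - s) (bul n (s + 1 - n) (x n) (y (s + 1 - n))) (z (r + 1 - s))"
  let ?R = "\<lambda>n m. bul n (r + 1 - n) (x n) (bul m (?k n m) (y m) (z (?k n m)))"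
  have L_closed: "?L s n \<in> carrier (P r)" if "s \<in> {1..r}" "n \<in> {1..s}" for s n
    using that by (intro bullet_closed_arity bullet_term_closed x y D_closed[OF z]) auto
  have inner_R: "bul m (?k n m) (y m) (z (?k n m)) \<in> carrier (P (r + 1 - n))"
    if "n \<in> {1..r}" "m \<in> {1..r + 1 - n}" for n m
  proof -
    have "m + ?k n m - 1 = r + 1 - n" "1 \<le> ?k n m" using that by auto
    then show ?thesis
      using bullet_closed[OF D_closed[OF y] D_closed[OF z], of m "?k n m"] that by simp
  qed
  have R_closed: "?R n m \<in> carrier (P r)" if "n \<in> {1..r}" "m \<in> {1..r + 1 - n}" for n m
    using that inner_R by (intro bullet_closed_arity D_closed[OF x]) auto
  have "((x \<otimes>\<^bsub>A\<^esub> y) \<otimes>\<^bsub>A\<^esub> z) r =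
      (\<Oplus>\<^bsub>P r\<^esub>s\<in>{1..r}. bul s (r + 1 - s) ((x \<otimes>\<^bsub>A\<^esub> y) s) (z (r + 1 - s)))"
    by (rule operad_algebra_mult[OF r])
  also have "\<dots> = (\<Oplus>\<^bsub>P r\<^esub>s\<in>{1..r}. \<Oplus>\<^bsub>P r\<^esub>n\<in>{1..s}. ?L s n)"
  proof (rule P.M.finsum_cong')
    fix s assume s: "s \<in> {1..r}"
    have "s + (r + 1 - s) - 1 = r" "1 \<le> r + 1 - s" using s by auto
    then show "bul s (r + 1 - s) ((x \<otimes>\<^bsub>A\<^esub> y) s) (z (r + 1 - s)) = (\<Oplus>\<^bsub>P r\<^esub>n\<in>{1..s}. ?L s n)"
      using bullet_finsum_l[of "\<lambda>n. bul n (s + 1 - n) (x n) (y (s + 1 - n))" "{1..s}" s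
          "z (r + 1 - s)" "r + 1 - s"] bullet_term_closed[OF x y] D_closed[OF z, of "r + 1 - s"]
        operad_algebra_mult[of s x y] s
      by (simp add: Pi_def)
  qed (use L_closed in \<open>auto intro!: P.M.finsum_closed\<close>)
  also have "\<dots> = (\<Oplus>\<^bsub>P r\<^esub>n\<in>{1..r}. \<Oplus>\<^bsub>P r\<^esub>m\<in>{1..r + 1 - n}. ?L (n + m - 1) n)"
  proof (rule P.M.finsum_nested_reindex)
    \<comment> \<open>Here \<open>s\<close> is the arity of a part of the product of
      \<open>x\<close> and \<open>y\<close>, composed of parts of arities \<open>n\<close> and
      \<open>m = s + 1 - n\<close>.\<close>
    show "bij_betw (\<lambda>(n, m). (n + m - 1, n)) (SIGMA n:{1..r}. {1..r + 1 - n})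
        (SIGMA s:{1..r}. {1..s})"
      by (rule bij_betwI[where g = "\<lambda>(s, n). (n, s + 1 - n)"]) auto
  qed (use L_closed in auto)
  also have "\<dots> = (\<Oplus>\<^bsub>P r\<^esub>n\<in>{1..r}. \<Oplus>\<^bsub>P r\<^esub>m\<in>{1..r + 1 - n}. ?R n m \<oplus>\<^bsub>P r\<^esub>
      double_insertion n m (?k n m) (x n) (y m) (z (?k n m)))"
  proof (intro P.M.finsum_cong' refl Pi_I P.M.finsum_closed P.M.a_closed R_closed
      double_insertion_term_closed)
    fix n m assume n: "n \<in> {1..r}" and m: "m \<in> {1..r + 1 - n}"
    have *: "r + 1 - (n + m - 1) = ?k n m" "n + m - 1 + 1 - n = m" "m + ?k n m - 1 = r + 1 - n"
      "n + m + ?k n m - 2 = r" "1 \<le> ?k n m" using n m by auto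
    show "?L (n + m - 1) n = ?R n m \<oplus>\<^bsub>P r\<^esub>
        double_insertion n m (?k n m) (x n) (y m) (z (?k n m))"
      using bullet_bullet[OF _ _ D_closed[OF x] D_closed[OF y] D_closed[OF z *(5)], of n m] n m
      unfolding * by simp
  qed
  also have "\<dots> = (\<Oplus>\<^bsub>P r\<^esub>n\<in>{1..r}. (\<Oplus>\<^bsub>P r\<^esub>m\<in>{1..r + 1 - n}. ?R n m) \<oplus>\<^bsub>P r\<^esub>
      (\<Oplus>\<^bsub>P r\<^esub>m\<in>{1..r + 1 - n}. double_insertion n m (?k n m) (x n) (y m) (z (?k n m))))"
    by (intro P.M.finsum_cong' refl Pi_I P.M.finsum_closed P.M.a_closed R_closed
      double_insertion_term_closed P.M.finsum_addf)
  also have "\<dots> = (\<Oplus>\<^bsub>P r\<^esub>n\<in>{1..r}. \<Oplus>\<^bsub>P r\<^esub>m\<in>{1..r + 1 - n}. ?R n m) \<oplus>\<^bsub>P r\<^esub>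
      triple_insertion x y z r"
    unfolding triple_insertion_def
    by (intro P.M.finsum_addf Pi_I P.M.finsum_closed R_closed double_insertion_term_closed)
  also have "(\<Oplus>\<^bsub>P r\<^esub>n\<in>{1..r}. \<Oplus>\<^bsub>P r\<^esub>m\<in>{1..r + 1 - n}. ?R n m) = (x \<otimes>\<^bsub>A\<^esub> (y \<otimes>\<^bsub>A\<^esub> z)) r"
    unfolding operad_algebra_mult[OF r]
  proof (rule P.M.finsum_cong')
    fix n assume n: "n \<in> {1..r}"
    have *: "n + (r + 1 - n) - 1 = r" "1 \<le> r + 1 - n" using n by auto
    have "(y \<otimes>\<^bsub>A\<^esub> z) (r + 1 - n) =
        (\<Oplus>\<^bsub>P (r + 1 - n)\<^esub>m\<in>{1..r + 1 - n}. bul m (r + 1 - n + 1 - m) (y m) (z (r + 1 - n + 1 - m)))"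
      by (rule operad_algebra_mult[OF *(2)])
    also have "\<dots> = (\<Oplus>\<^bsub>P (r + 1 - n)\<^esub>m\<in>{1..r + 1 - n}. bul m (?k n m) (y m) (z (?k n m)))"
    proof (rule P.M.finsum_cong')
      fix m
      have "r + 1 - n + 1 - m = ?k n m" using n by auto
      then show "bul m (r + 1 - n + 1 - m) (y m) (z (r + 1 - n + 1 - m)) =
        bul m (?k n m) (y m) (z (?k n m))" by simp
    qed (use inner_R[OF n] in auto)
    finally show "(\<Oplus>\<^bsub>P r\<^esub>m\<in>{1..r + 1 - n}. ?R n m) =
        bul n (r + 1 - n) (x n) ((y \<otimes>\<^bsub>A\<^esub> z) (r + 1 - n))"
      using bullet_finsum_r[of "x n" n "\<lambda>m. bul m (?k n m) (y m) (z (?k n m))"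
          "{1..r + 1 - n}" "r + 1 - n"] D_closed[OF x, of n] inner_R[OF n] n * by (simp add: Pi_def)
  qed (use x y z operad_algebra_mult_closed bullet_term_closed in auto)
  finally show ?thesis .
qed

end

lemma operad_algebra_right_pre_lie:
  assumes x: "x \<in> carrier D" and y: "y \<in> carrier D" and z: "z \<in> carrier D"
  shows "(x \<otimes>\<^bsub>A\<^esub> (y \<otimes>\<^bsub>A\<^esub> z)) \<ominus>\<^bsub>D\<^esub> ((x \<otimes>\<^bsub>A\<^esub> y) \<otimes>\<^bsub>A\<^esub> z) =
    (x \<otimes>\<^bsub>A\<^esub> (z \<otimes>\<^bsub>A\<^esub> y)) \<ominus>\<^bsub>D\<^esub> ((x \<otimes>\<^bsub>A\<^esub> z) \<otimes>\<^bsub>A\<^esub> y)"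
proof (rule direct_sum_eqI)
  note closed = operad_algebra_mult_closed
  fix r :: nat assume "r \<in> {1..}"
  then have r: "r \<ge> 1" by simp
  \<comment> \<open>Stated for all \<open>y\<close> and \<open>z\<close>, so that both sides of the
    identity become negatives of triple insertions, which agree by symmetry.\<close>
  have *: "((x \<otimes>\<^bsub>A\<^esub> (y \<otimes>\<^bsub>A\<^esub> z)) \<ominus>\<^bsub>D\<^esub> ((x \<otimes>\<^bsub>A\<^esub> y) \<otimes>\<^bsub>A\<^esub> z)) r =
      \<ominus>\<^bsub>P r\<^esub> triple_insertion x y z r"
    if "y \<in> carrier D" "z \<in> carrier D" for y z
  proof -
    have c: "(x \<otimes>\<^bsub>A\<^esub> (y \<otimes>\<^bsub>A\<^esub> z)) r \<in> carrier (P r)" "triple_insertion x y z r \<in> carrier (P r)"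
      using that x closed r by (auto intro: D_closed triple_insertion_closed)
    have "((x \<otimes>\<^bsub>A\<^esub> (y \<otimes>\<^bsub>A\<^esub> z)) \<ominus>\<^bsub>D\<^esub> ((x \<otimes>\<^bsub>A\<^esub> y) \<otimes>\<^bsub>A\<^esub> z)) r =
      (x \<otimes>\<^bsub>A\<^esub> (y \<otimes>\<^bsub>A\<^esub> z)) r \<ominus>\<^bsub>P r\<^esub> ((x \<otimes>\<^bsub>A\<^esub> y) \<otimes>\<^bsub>A\<^esub> z) r"
      by (rule direct_sum_minus[OF is_cring module_P]) (use that x closed r in auto)
    also have "\<dots> = \<ominus>\<^bsub>P r\<^esub> triple_insertion x y z r"
      unfolding operad_algebra_mult_mult[OF x that r] using c
      by (simp add: a_minus_def P.M.minus_add P.M.r_neg flip: P.M.a_assoc)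
    finally show ?thesis .
  qed
  show "((x \<otimes>\<^bsub>A\<^esub> (y \<otimes>\<^bsub>A\<^esub> z)) \<ominus>\<^bsub>D\<^esub> ((x \<otimes>\<^bsub>A\<^esub> y) \<otimes>\<^bsub>A\<^esub> z)) r =
    ((x \<otimes>\<^bsub>A\<^esub> (z \<otimes>\<^bsub>A\<^esub> y)) \<ominus>\<^bsub>D\<^esub> ((x \<otimes>\<^bsub>A\<^esub> z) \<otimes>\<^bsub>A\<^esub> y)) r"
    using *[OF y z] *[OF z y] triple_insertion_swap[OF x y z r] by simp
qed (use x y z operad_algebra_mult_closed in auto)

lemma operad_algebra_pre_lie: "pre_lie_algebra K A"
  by (intro pre_lie_algebra.intro pre_lie_algebra_axioms.intro)
    (simp_all add: operad_algebra_sel operad_algebra_mult_closed operad_algebra_l_distr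
      operad_algebra_r_distr operad_algebra_smult_l operad_algebra_smult_r
      operad_algebra_right_pre_lie,
     simp add: operad_algebra_def module_mult_update D.module_axioms)

end

end

subsection \<open>Quotients of graded pre-Lie algebras\<close>

text \<open>Components and unique decomposition depend only on the module structure; the product
  enters through the degree condition. Both \<open>P\<close> and its coinvariants are graded in this
  way.\<close>

lemma graded_pre_lie_direct_sumI:
  fixes M :: "nat \<Rightarrow> ('k, 'a) module"
  assumes "\<And>n. module K (M n)" "pre_lie_algebra K ((direct_sum {1..} M)\<lparr>mult := m\<rparr>)"
    and "\<And>x y d e. x \<in> degree_part M d \<Longrightarrow> y \<in> degree_part M e \<Longrightarrow> m x y \<in> degree_part M (d + e)"
  shows "graded_pre_lie_algebra K ((direct_sum {1..} M)\<lparr>mult := m\<rparr>) (degree_part M)"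
proof -
  have cring: "cring K" using assms(1) by (auto simp: module_def)
  show ?thesis
    using assms direct_sum_unique_decomposition[OF cring assms(1)]
      direct_sum_component_submodule[OF cring assms(1)]
    by (intro graded_pre_lie_algebra.intro graded_pre_lie_algebra_axioms.intro)
      (simp_all add: submodule_mult_update finsum_mult_update degree_part_def)
qed

text \<open>The product is computed on representatives picked by a section of \<open>h\<close>; the
  congruence assumption makes the result independent of the choice. The restrictions to
  \<open>B\<close> make it extensional, as uniqueness of a function requires.\<close>

lemma quotient_product_exists:
  assumes "h ` A = B"
    and "\<And>x x' y y'. \<lbrakk>x \<in> A; x' \<in> A; y \<in> A; y' \<in> A; h x = h x'; h y = h y'\<rbrakk> \<Longrightarrow>
      h (f x y) = h (f x' y')"
    and "\<And>x y. x \<in> A \<Longrightarrow> y \<in> A \<Longrightarrow> f x y \<in> A"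
  shows "\<exists>m. m \<in> B \<rightarrow>\<^sub>E B \<rightarrow>\<^sub>E B \<and> (\<forall>x\<in>A. \<forall>y\<in>A. m (h x) (h y) = h (f x y))"
proof -
  define s where "s = inv_into A h"
  have s: "s X \<in> A" "h (s X) = X" if "X \<in> B" for X
    using that assms(1) by (auto simp: s_def inv_into_into f_inv_into_f)
  have hB: "h x \<in> B" if "x \<in> A" for x using that assms(1) by blast
  let ?m = "\<lambda>X\<in>B. \<lambda>Y\<in>B. h (f (s X) (s Y))"
  have "?m (h x) (h y) = h (f x y)" if "x \<in> A" "y \<in> A" for x y
    using assms(2)[OF s(1)[OF hB] _ s(1)[OF hB]] s(2)[OF hB] that hB by simp
  moreover have "?m \<in> B \<rightarrow>\<^sub>E B \<rightarrow>\<^sub>E B" using s(1) assms(3) hB by auto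
  ultimately show ?thesis by blast
qed

text \<open>All the axioms are identities, so they survive along a surjection: each element of
  \<open>B\<close> is written as \<open>h x\<close>, and \<open>h\<close> is pulled out of both
  sides.\<close>

lemma quotient_pre_lie_algebra:
  fixes A :: "('k, 'a) module" and B :: "('k, 'b) module"
  assumes "pre_lie_algebra K A" "module K B" and onto: "h ` carrier A = carrier B"
    and add: "\<And>x y. x \<in> carrier A \<Longrightarrow> y \<in> carrier A \<Longrightarrow> h (x \<oplus>\<^bsub>A\<^esub> y) = h x \<oplus>\<^bsub>B\<^esub> h y"
    and smult: "\<And>a x. a \<in> carrier K \<Longrightarrow> x \<in> carrier A \<Longrightarrow> h (a \<odot>\<^bsub>A\<^esub> x) = a \<odot>\<^bsub>B\<^esub> h x"
    and mult: "\<And>x y. x \<in> carrier A \<Longrightarrow> y \<in> carrier A \<Longrightarrow> m (h x) (h y) = h (x \<otimes>\<^bsub>A\<^esub> y)"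
  shows "pre_lie_algebra K (B\<lparr>mult := m\<rparr>)"
proof -
  interpret A: pre_lie_algebra K A by fact
  interpret B: module K B by fact
  have "h x \<in> carrier B" if "x \<in> carrier A" for x using onto that by blast
  then have minus: "h x \<ominus>\<^bsub>B\<^esub> h y = h (x \<ominus>\<^bsub>A\<^esub> y)" if "x \<in> carrier A" "y \<in> carrier A" for x y
    using that add by (intro additive_minus[symmetric])
      (auto intro: A.M.abelian_group_axioms B.M.abelian_group_axioms)
  show ?thesis
    by (intro pre_lie_algebra.intro module_mult_update pre_lie_algebra_axioms.intro,
        rule assms(2), unfold a_minus_mult_update)
      (auto simp: onto[symmetric] mult A.prod_closed A.prod_l_distr A.prod_r_distr
        A.prod_smult_l A.prod_smult_r minus add[symmetric] smult[symmetric] A.right_pre_lie)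
qed

context operad
begin

context
  notes One_nat_def [simp del]
begin

subsection \<open>The coinvariants\<close>

abbreviation Q where "Q \<equiv> coinv K P act"

abbreviation proj where "proj \<equiv> coinv_proj K P act"

lemma coinv_sel:
  "carrier (Q n) = (\<lambda>x. ker n +>\<^bsub>P n\<^esub> x) ` carrier (P n)"
  "\<zero>\<^bsub>Q n\<^esub> = ker n"
  "\<lbrakk>x \<in> carrier (P n); y \<in> carrier (P n)\<rbrakk> \<Longrightarrow>
    (ker n +>\<^bsub>P n\<^esub> x) \<oplus>\<^bsub>Q n\<^esub> (ker n +>\<^bsub>P n\<^esub> y) = ker n +>\<^bsub>P n\<^esub> (x \<oplus>\<^bsub>P n\<^esub> y)"
  "\<lbrakk>a \<in> carrier K; x \<in> carrier (P n)\<rbrakk> \<Longrightarrow>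
    a \<odot>\<^bsub>Q n\<^esub> (ker n +>\<^bsub>P n\<^esub> x) = ker n +>\<^bsub>P n\<^esub> (a \<odot>\<^bsub>P n\<^esub> x)"
  unfolding coinv_def using quotient_module_sel[OF module_P coinv_kernel_submodule] by auto

lemma coinv_module: "module K (Q n)"
  unfolding coinv_def by (rule quotient_module_module[OF module_P coinv_kernel_submodule])

lemma coinv_sum_module: "module K (coinv_sum K P act)"
  unfolding coinv_sum_def by (rule direct_sum_module[OF is_cring coinv_module])

lemma coinv_proj_component: "n \<ge> 1 \<Longrightarrow> proj x n = ker n +>\<^bsub>P n\<^esub> x n"
  by (simp add: coinv_proj_def)

lemma coset_zero: "ker n +>\<^bsub>P n\<^esub> \<zero>\<^bsub>P n\<^esub> = \<zero>\<^bsub>Q n\<^esub>"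
  using P.submoduleE(1)[OF coinv_kernel_submodule] by (simp add: coinv_sel)

lemma coinv_proj_closed:
  assumes x: "x \<in> carrier D"
  shows "proj x \<in> carrier (coinv_sum K P act)"
  unfolding coinv_sum_def
  by (rule direct_sum_carrierI[OF _ _ direct_sum_finite_support[OF x]])
    (use D_closed[OF x] in \<open>auto simp: coinv_proj_component coinv_sel(1) coset_zero,
      auto simp: coinv_proj_def\<close>)

lemma coinv_proj_add:
  assumes x: "x \<in> carrier D" and y: "y \<in> carrier D"
  shows "proj (x \<oplus>\<^bsub>D\<^esub> y) = proj x \<oplus>\<^bsub>coinv_sum K P act\<^esub> proj y"
  unfolding coinv_sum_def
proof (rule direct_sum_eqI[of _ "{1..}" Q], fold coinv_sum_def)
  interpret module K "coinv_sum K P act" by (rule coinv_sum_module)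
  show "proj x \<oplus>\<^bsub>coinv_sum K P act\<^esub> proj y \<in> carrier (coinv_sum K P act)"
    by (intro M.a_closed coinv_proj_closed x y)
  show "proj (x \<oplus>\<^bsub>D\<^esub> y) \<in> carrier (coinv_sum K P act)"
    by (intro coinv_proj_closed D.M.a_closed x y)
  show "proj (x \<oplus>\<^bsub>D\<^esub> y) n = (proj x \<oplus>\<^bsub>coinv_sum K P act\<^esub> proj y) n" if "n \<in> {1..}" for n
    using that D_closed[OF x, of n] D_closed[OF y, of n]
    by (simp add: coinv_sum_def coinv_proj_component coinv_sel(3))
qed

lemma coinv_proj_smult:
  assumes a: "a \<in> carrier K" and x: "x \<in> carrier D"
  shows "proj (a \<odot>\<^bsub>D\<^esub> x) = a \<odot>\<^bsub>coinv_sum K P act\<^esub> proj x"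
  unfolding coinv_sum_def
proof (rule direct_sum_eqI[of _ "{1..}" Q], fold coinv_sum_def)
  interpret Q: module K "coinv_sum K P act" by (rule coinv_sum_module)
  show "a \<odot>\<^bsub>coinv_sum K P act\<^esub> proj x \<in> carrier (coinv_sum K P act)"
    by (intro Q.smult_closed coinv_proj_closed a x)
  show "proj (a \<odot>\<^bsub>D\<^esub> x) \<in> carrier (coinv_sum K P act)"
    by (intro coinv_proj_closed D.smult_closed a x)
  show "proj (a \<odot>\<^bsub>D\<^esub> x) n = (a \<odot>\<^bsub>coinv_sum K P act\<^esub> proj x) n" if "n \<in> {1..}" for n
    using that a D_closed[OF x, of n]
    by (simp add: coinv_sum_def coinv_proj_component coinv_sel(4))
qed

text \<open>Turns independence of representatives into a statement about differences, to which the
  ideal property applies.\<close>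

lemma coinv_proj_eq_iff:
  assumes x: "x \<in> carrier D" and y: "y \<in> carrier D"
  shows "proj x = proj y \<longleftrightarrow> (\<forall>n\<ge>1. (x \<ominus>\<^bsub>D\<^esub> y) n \<in> ker n)"
proof -
  have "proj x = proj y \<longleftrightarrow> (\<forall>n\<ge>1. proj x n = proj y n)"
  proof
    assume *: "\<forall>n\<ge>1. proj x n = proj y n"
    show "proj x = proj y"
      using coinv_proj_closed[OF x] coinv_proj_closed[OF y] * unfolding coinv_sum_def
      by (intro direct_sum_eqI[of _ "{1..}" Q]) auto
  qed simp
  moreover have "proj x n = proj y n \<longleftrightarrow> (x \<ominus>\<^bsub>D\<^esub> y) n \<in> ker n" if "n \<ge> 1" for n
    using P.coset_eq_iff[OF coinv_kernel_submodule D_closed[OF x that] D_closed[OF y that]]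
      direct_sum_minus[OF is_cring module_P x y, of n] that
    by (simp add: coinv_proj_component)
  ultimately show ?thesis by blast
qed

lemma coinv_proj_lift:
  assumes X: "X \<in> carrier (coinv_sum K P act)"
  obtains x where "x \<in> carrier D" "proj x = X" "\<And>n. n \<ge> 1 \<Longrightarrow> X n = \<zero>\<^bsub>Q n\<^esub> \<Longrightarrow> x n = \<zero>\<^bsub>P n\<^esub>"
proof
  \<comment> \<open>The zero coset is lifted to zero rather than to an arbitrary element of the
    kernel. This keeps the support of the lift finite, and later keeps lifts of homogeneous elements
    homogeneous.\<close>
  define s where "s n = (if X n = \<zero>\<^bsub>Q n\<^esub> then \<zero>\<^bsub>P n\<^esub>
    else SOME p. p \<in> carrier (P n) \<and> X n = ker n +>\<^bsub>P n\<^esub> p)" for n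
  have s: "s n \<in> carrier (P n) \<and> X n = ker n +>\<^bsub>P n\<^esub> s n" if "n \<ge> 1" for n
  proof (cases "X n = \<zero>\<^bsub>Q n\<^esub>")
    case True
    then show ?thesis by (simp add: s_def coset_zero)
  next
    case False
    have "X n \<in> carrier (Q n)"
      using X that unfolding coinv_sum_def by (intro direct_sum_component_closed[of X "{1..}" Q]) auto
    then have "\<exists>p. p \<in> carrier (P n) \<and> X n = ker n +>\<^bsub>P n\<^esub> p" by (auto simp: coinv_sel(1))
    then show ?thesis using someI_ex False unfolding s_def by (simp only: if_False)
  qed
  let ?x = "\<lambda>n\<in>{1..}. s n"
  show x: "?x \<in> carrier D"
    by (rule direct_sum_carrierI[OF _ _ direct_sum_finite_support[OF X[unfolded coinv_sum_def]]])
      (use s in \<open>auto simp: s_def\<close>)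
  show "proj ?x = X"
    using coinv_proj_closed[OF x] X unfolding coinv_sum_def
    by (rule direct_sum_eqI) (use s in \<open>auto simp: coinv_proj_component\<close>)
  show "?x n = \<zero>\<^bsub>P n\<^esub>" if "n \<ge> 1" "X n = \<zero>\<^bsub>Q n\<^esub>" for n
    using that by (simp add: s_def)
qed

lemma coinv_proj_onto: "proj ` carrier D = carrier (coinv_sum K P act)"
  using coinv_proj_closed coinv_proj_lift by (auto simp: image_iff) metis

lemma coinv_proj_degree: "x \<in> degree_part P d \<Longrightarrow> proj x \<in> degree_part Q d"
  using coinv_proj_closed[of x]
  by (auto simp: degree_part_def direct_sum_component_def coinv_sum_def coinv_proj_component coset_zero)

lemma coinv_proj_degree_lift:
  assumes "X \<in> degree_part Q d"
  obtains x where "x \<in> degree_part P d" "proj x = X"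
proof -
  have X: "X \<in> carrier (coinv_sum K P act)"
    "\<And>n. n \<ge> 1 \<Longrightarrow> n \<noteq> d + 1 \<Longrightarrow> X n = \<zero>\<^bsub>Q n\<^esub>"
    using assms by (auto simp: degree_part_def direct_sum_component_def coinv_sum_def)
  obtain x where "x \<in> carrier D" "proj x = X" "\<And>n. n \<ge> 1 \<Longrightarrow> X n = \<zero>\<^bsub>Q n\<^esub> \<Longrightarrow> x n = \<zero>\<^bsub>P n\<^esub>"
    using coinv_proj_lift[OF X(1)] by blast
  then show thesis
    using X(2) by (intro that[of x]) (auto simp: degree_part_def direct_sum_component_def)
qed

section \<open>Compatibility of the product with the projection\<close>

lemma coinv_kernel_mult_r:
  assumes x: "x \<in> carrier D" and y: "y \<in> carrier D" "\<forall>n\<ge>1. y n \<in> ker n" and r: "r \<ge> 1"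
  shows "(x \<otimes>\<^bsub>A\<^esub> y) r \<in> ker r"
  unfolding operad_algebra_mult[OF r]
proof (rule P.submodule_finsum[OF coinv_kernel_submodule])
  fix n assume n: "n \<in> {1..r}"
  have "n + (r + 1 - n) - 1 = r" "1 \<le> n" "1 \<le> r + 1 - n" using n by auto
  then show "bul n (r + 1 - n) (x n) (y (r + 1 - n)) \<in> ker r"
    using coinv_kernel_bullet_r[OF D_closed[OF x], of n "y (r + 1 - n)" "r + 1 - n"] y(2) by metis
qed

lemma coinv_kernel_mult_l:
  assumes x: "x \<in> carrier D" "\<forall>n\<ge>1. x n \<in> ker n" and y: "y \<in> carrier D" and r: "r \<ge> 1"
  shows "(x \<otimes>\<^bsub>A\<^esub> y) r \<in> ker r"
  unfolding operad_algebra_mult[OF r]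
proof (rule P.submodule_finsum[OF coinv_kernel_submodule])
  fix n assume n: "n \<in> {1..r}"
  have "n + (r + 1 - n) - 1 = r" "1 \<le> n" "1 \<le> r + 1 - n" using n by auto
  then show "bul n (r + 1 - n) (x n) (y (r + 1 - n)) \<in> ker r"
    using coinv_kernel_bullet_l[OF _ D_closed[OF y], of "x n" n "r + 1 - n"] x(2) by metis
qed

text \<open>The factors are changed one at a time; by bilinearity each difference is a product with
  one factor in the kernel.\<close>

lemma coinv_proj_mult_cong:
  assumes x: "x \<in> carrier D" "x' \<in> carrier D" and y: "y \<in> carrier D" "y' \<in> carrier D"
    and eq: "proj x = proj x'" "proj y = proj y'"
  shows "proj (x \<otimes>\<^bsub>A\<^esub> y) = proj (x' \<otimes>\<^bsub>A\<^esub> y')"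
proof -
  note closed = operad_algebra_mult_closed
  have "proj (x \<otimes>\<^bsub>A\<^esub> y) = proj (x' \<otimes>\<^bsub>A\<^esub> y)"
  proof -
    have "(x \<otimes>\<^bsub>A\<^esub> y) \<ominus>\<^bsub>D\<^esub> (x' \<otimes>\<^bsub>A\<^esub> y) = (x \<ominus>\<^bsub>D\<^esub> x') \<otimes>\<^bsub>A\<^esub> y"
      by (rule additive_minus[symmetric, where h = "\<lambda>x. x \<otimes>\<^bsub>A\<^esub> y"])
        (use x y in \<open>auto intro: D.M.abelian_group_axioms closed operad_algebra_l_distr\<close>)
    then show ?thesis
      using coinv_kernel_mult_l[OF D.M.minus_closed[OF x] _ y(1)] eq(1)
      by (simp add: coinv_proj_eq_iff x y closed)
  qed
  also have "\<dots> = proj (x' \<otimes>\<^bsub>A\<^esub> y')"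
  proof -
    have "(x' \<otimes>\<^bsub>A\<^esub> y) \<ominus>\<^bsub>D\<^esub> (x' \<otimes>\<^bsub>A\<^esub> y') = x' \<otimes>\<^bsub>A\<^esub> (y \<ominus>\<^bsub>D\<^esub> y')"
      by (rule additive_minus[symmetric, where h = "\<lambda>y. x' \<otimes>\<^bsub>A\<^esub> y"])
        (use x y in \<open>auto intro: D.M.abelian_group_axioms closed operad_algebra_r_distr\<close>)
    then show ?thesis
      using coinv_kernel_mult_r[OF x(2) D.M.minus_closed[OF y]] eq(2)
      by (simp add: coinv_proj_eq_iff x y closed)
  qed
  finally show ?thesis .
qed

lemma operad_algebra_graded: "graded_pre_lie_algebra K A (degree_part P)"
  using graded_pre_lie_direct_sumI[OF module_P operad_algebra_pre_lie[unfolded operad_algebra_def]]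
    operad_algebra_mult_degree
  by (simp add: operad_algebra_def)

text \<open>The pre-Lie axioms come from the surjection; the degree condition holds because
  homogeneous elements have homogeneous lifts.\<close>

lemma coinv_algebra_graded:
  assumes mult: "\<And>x y. x \<in> carrier D \<Longrightarrow> y \<in> carrier D \<Longrightarrow> m (proj x) (proj y) = proj (x \<otimes>\<^bsub>A\<^esub> y)"
  shows "graded_pre_lie_algebra K (coinv_algebra K P act m) (degree_part Q)"
  unfolding coinv_algebra_def coinv_sum_def
proof (rule graded_pre_lie_direct_sumI[OF coinv_module], fold coinv_sum_def)
  show "pre_lie_algebra K ((coinv_sum K P act)\<lparr>mult := m\<rparr>)"
    by (rule quotient_pre_lie_algebra[OF operad_algebra_pre_lie coinv_sum_module, of proj])
      (simp_all add: operad_algebra_sel coinv_proj_onto coinv_proj_add coinv_proj_smult mult)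
  fix X Y d e assume "X \<in> degree_part Q d" "Y \<in> degree_part Q e"
  then obtain x y where xy: "x \<in> degree_part P d" "proj x = X" "y \<in> degree_part P e" "proj y = Y"
    using coinv_proj_degree_lift by metis
  then have "x \<in> carrier D" "y \<in> carrier D"
    by (auto simp: degree_part_def direct_sum_component_def)
  then have "m X Y = proj (x \<otimes>\<^bsub>A\<^esub> y)" using mult xy by blast
  then show "m X Y \<in> degree_part Q (d + e)"
    using coinv_proj_degree[OF operad_algebra_mult_degree[OF xy(1,3)]] by simp
qed

text \<open>Linearity and degree preservation of the projection do not involve \<open>m\<close>, so
  being a homomorphism amounts to the equation that prescribes \<open>m\<close> on images.\<close>

lemma coinv_proj_graded_hom_iff:
  "proj \<in> graded_algebra_hom K A (degree_part P) (coinv_algebra K P act m) (degree_part Q) \<longleftrightarrow>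
    (\<forall>x\<in>carrier D. \<forall>y\<in>carrier D. m (proj x) (proj y) = proj (x \<otimes>\<^bsub>A\<^esub> y))"
  by (auto simp: graded_algebra_hom_def coinv_algebra_def operad_algebra_sel coinv_proj_closed
      coinv_proj_add coinv_proj_smult coinv_proj_degree)

end

end

theorem corollary39:
  fixes K :: "('k, 'm) ring_scheme"
    and P :: "nat \<Rightarrow> ('k, 'a) module"
    and act :: "nat \<Rightarrow> 'a \<Rightarrow> (nat \<Rightarrow> nat) \<Rightarrow> 'a"
    and \<gamma> :: "nat list \<Rightarrow> 'a \<Rightarrow> 'a list \<Rightarrow> 'a"
    and I :: 'a
  assumes "operad K P act \<gamma> I"
    and "carrier (P 0) = {\<zero>\<^bsub>P 0\<^esub>}"
  shows "graded_pre_lie_algebra K (operad_algebra P \<gamma> I) (degree_part P) \<and>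
    (\<exists>!m. m \<in> carrier (coinv_sum K P act) \<rightarrow>\<^sub>E
        carrier (coinv_sum K P act) \<rightarrow>\<^sub>E carrier (coinv_sum K P act) \<and>
      graded_pre_lie_algebra K (coinv_algebra K P act m) (degree_part (coinv K P act)) \<and>
      coinv_proj K P act \<in>
        graded_algebra_hom K (operad_algebra P \<gamma> I) (degree_part P)
          (coinv_algebra K P act m) (degree_part (coinv K P act)) \<and>
      coinv_proj K P act ` carrier (operad_algebra P \<gamma> I) = carrier (coinv_sum K P act))"
proof -
  interpret operad K P act \<gamma> I by fact
  let ?C = "carrier (coinv_sum K P act)"
  have "\<exists>m. m \<in> ?C \<rightarrow>\<^sub>E ?C \<rightarrow>\<^sub>E ?C \<and>
      (\<forall>x\<in>carrier D. \<forall>y\<in>carrier D. m (proj x) (proj y) = proj (x \<otimes>\<^bsub>A\<^esub> y))"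
    by (rule quotient_product_exists[OF coinv_proj_onto])
      (fact coinv_proj_mult_cong, fact operad_algebra_mult_closed)
  then obtain m where m: "m \<in> ?C \<rightarrow>\<^sub>E ?C \<rightarrow>\<^sub>E ?C"
    "\<forall>x\<in>carrier D. \<forall>y\<in>carrier D. m (proj x) (proj y) = proj (x \<otimes>\<^bsub>A\<^esub> y)"
    by (elim exE conjE)
  have unique: "m' = m" if m': "m' \<in> ?C \<rightarrow>\<^sub>E ?C \<rightarrow>\<^sub>E ?C"
    "\<forall>x\<in>carrier D. \<forall>y\<in>carrier D. m' (proj x) (proj y) = proj (x \<otimes>\<^bsub>A\<^esub> y)" for m'
  \<comment> \<open>Extensional functions are determined on the carrier, and every element there is
    the image of a representative.\<close>
  proof (rule PiE_ext[OF m'(1) m(1)])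
    fix X assume X: "X \<in> ?C"
    show "m' X = m X"
    proof (rule PiE_ext[of _ ?C "\<lambda>_. ?C"])
      show "m' X \<in> ?C \<rightarrow>\<^sub>E ?C" "m X \<in> ?C \<rightarrow>\<^sub>E ?C" using m(1) m'(1) X by auto
      fix Y assume "Y \<in> ?C"
      then obtain x y where "x \<in> carrier D" "y \<in> carrier D" "X = proj x" "Y = proj y"
        using X unfolding coinv_proj_onto[symmetric] by blast
      then show "m' X Y = m X Y" using m(2) m'(2) by simp
    qed
  qed
  have onto: "proj ` carrier A = ?C"
    using coinv_proj_onto by (simp only: operad_algebra_sel(1))
  have graded: "graded_pre_lie_algebra K (coinv_algebra K P act m) (degree_part Q)"
    using m(2) by (intro coinv_algebra_graded) blast
  show ?thesis
    \<comment> \<open>The homomorphism condition becomes the equation on representatives for which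
      \<open>m\<close> was obtained and \<open>unique\<close> was proved.\<close>
    unfolding coinv_proj_graded_hom_iff
  proof (intro conjI operad_algebra_graded ex1I[of _ m])
    fix m'
    assume "m' \<in> ?C \<rightarrow>\<^sub>E ?C \<rightarrow>\<^sub>E ?C \<and>
      graded_pre_lie_algebra K (coinv_algebra K P act m') (degree_part Q) \<and>
      (\<forall>x\<in>carrier D. \<forall>y\<in>carrier D. m' (proj x) (proj y) = proj (x \<otimes>\<^bsub>A\<^esub> y)) \<and>
      proj ` carrier A = ?C"
    then show "m' = m" by (elim conjE) (rule unique)
  qed (fact m graded onto)+
qed

end
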